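(* Let $\mathcal{B}$ be a symmetric basis of a Banach space $\mathbb{X}$. The following are equivalent: (i) $\mathcal{B}$ is an unconditional basis. (ii) $\mathcal{B}$ is bidemocratic. (iii) $\mathcal{B}$ is super-democratic. (iv) $\mathcal{B}$ is unconditional for constant coefficients. (v) $\mathcal{B}$ is a Markushevich basis.
   Context: Banach spaces are over $\mathbb{F}=\mathbb{R}$ or $\mathbb{C}$; $\mathbb{E}=\{\lambda\in\mathbb{F}:|\lambda|=1\}$; $c_{00}$ is the space of finitely supported scalar sequences. Basis: a basis of $\mathbb{X}$ is a sequence $\mathcal{B}=(\boldsymbol{x}_n)_{n=1}^\infty$ in $\mathbb{X}$ whose linear span is dense in $\mathbb{X}$, for which there is a (necessarily unique) sequence $\mathcal{B}^*=(\boldsymbol{x}_n^* )_{n=1}^\infty$ in $\mathbb{X}^*$ biorthogonal to $\mathcal{B}$, and such that $\sup_n\max\{\|\boldsymbol{x}_n\|,\|\boldsymbol{x}_n^*\|\}<\infty$. Totality is not assumed. Markushevich basis: a basis that is moreover total, i.e. the span of $\mathcal{B}^*$ is weak$^*$-dense in $\mathbb{X}^*$. Symmetric: for every permutation $\pi$ of $\mathbb{N}$ the sequence $(\boldsymbol{x}_{\pi(n)})_n$ is equivalent to $(\boldsymbol{x}_n)_n$, i.e. there is $C_\pi\ge1$ with $C_\pi^{-1}\|\sum a_n\boldsymbol{x}_n\|\le\|\sum a_n\boldsymbol{x}_{\pi(n)}\|\le C_\pi\|\sum a_n\boldsymbol{x}_n\|$ for all $(a_n)\in c_{00}$. By a standard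 argument this is equivalent to being $C$-symmetric for some $C$: $\|\sum a_n\boldsymbol{x}_n\|\le C\|\sum a_n\boldsymbol{x}_{\pi(n)}\|$ for all $(a_n)\in c_{00}$ and all permutations $\pi$. Unconditional: for every $x\in\mathbb{X}$ and every permutation $\pi$ of $\mathbb{N}$ the series $\sum_i\boldsymbol{x}^*_{\pi(i)}(x)\boldsymbol{x}_{\pi(i)}$ converges to $x$; equivalently, there is $K\ge1$ with $\|\sum_{n\in A}\boldsymbol{x}_n^*(x)\boldsymbol{x}_n\|\le K\|x\|$ for all finite $A\subset\mathbb{N}$ and $x\in\mathbb{X}$. For finite $A\subset\mathbb{N}$ and $\varepsilon\in\mathbb{E}^A$, $\mathbb{1}_{\varepsilon,A}=\sum_{n\in A}\varepsilon_n\boldsymbol{x}_n$ and $\mathbb{1}^*_{\varepsilon,A}=\sum_{n\in A}\varepsilon_n\boldsymbol{x}_n^*$. Bidemocratic: there is $C$ with $\|\mathbb{1}_{\varepsilon,A}\|\,\|\mathbb{1}^*_{\delta,B}\|\le Cm$ for all $m\in\mathbb{N}$, all $A,B\subset\mathbb{N}$ with $\max\{|A|,|B|\}\le m$, and all $\varepsilon\in\mathbb{E}^A$, $\delta\in\mathbb{E}^B$. Super-democratic: there is $C$ with $\|\mathbb{1}_{\varepsilon,A}\|\le C\|\mathbb{1}_{\delta,B}\|$ for all finite $A,B\subset\mathbb{N}$ with $|A|=|B|$ and all $\varepsilon\in\mathbb{E}^A$, $\delta\in\mathbb{E}^B$. Unconditional for constant coefficients: there is $C$ with $\|\mathbb{1}_{\varepsilon,A}\|\le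 C\|\mathbb{1}_{\delta,A}\|$ for all finite $A\subset\mathbb{N}$ and all $\varepsilon,\delta\in\mathbb{E}^A$. *)

theory Defs
  imports "HOL-Analysis.Analysis"
begin

text \<open>
  The library has no class of complex normed spaces. A Banach space over the scalar field
  \<open>'k\<close> (below always \<open>real\<close> or \<open>complex\<close>) is a type of class \<open>banach\<close> together with a scalar
  multiplication by \<open>'k\<close> that extends the real one and for which the norm is homogeneous.
  The definitions take that multiplication as their argument \<open>s\<close>.
\<close>

locale normed_space_over = vector_space s
  for s :: "'k::real_normed_field \<Rightarrow> 'a::real_normed_vector \<Rightarrow> 'a" +
  assumes scale_of_real: "s (of_real r) v = r *\<^sub>R v"
    and norm_scale: "norm (s c v) = norm c * norm v"

lemma normed_space_over_scaleR:
  "normed_space_over (scaleR :: real \<Rightarrow> 'a::real_normed_vector \<Rightarrow> 'a)"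
  by unfold_locales (auto simp: algebra_simps)

lemma normed_space_over_times:
  "normed_space_over ((*) :: 'k::real_normed_field \<Rightarrow> 'k \<Rightarrow> 'k)"
  by unfold_locales (auto simp: algebra_simps norm_mult scaleR_conv_of_real)

text \<open>The norm of an element of the dual space is \<^const>\<open>onorm\<close>.\<close>

definition dual_space ::
    "('k::real_normed_field \<Rightarrow> 'a::real_normed_vector \<Rightarrow> 'a) \<Rightarrow> ('a \<Rightarrow> 'k) set" where
  "dual_space s = {f. Vector_Spaces.linear s (*) f \<and> (\<exists>K. \<forall>v. norm (f v) \<le> K * norm v)}"

text \<open>The topology of pointwise convergence on the dual space.\<close>

definition weak_star_topology ::
    "('k::real_normed_field \<Rightarrow> 'a::real_normed_vector \<Rightarrow> 'a) \<Rightarrow> ('a \<Rightarrow> 'k) topology" where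
  "weak_star_topology s =
     subtopology (product_topology (\<lambda>_::'a. euclidean :: 'k topology) UNIV) (dual_space s)"

definition biorthogonal_functionals ::
    "('k::real_normed_field \<Rightarrow> 'a::real_normed_vector \<Rightarrow> 'a) \<Rightarrow> (nat \<Rightarrow> 'a) \<Rightarrow> (nat \<Rightarrow> 'a \<Rightarrow> 'k) \<Rightarrow> bool"
  where
  "biorthogonal_functionals s x xs \<longleftrightarrow>
     (\<forall>n. xs n \<in> dual_space s) \<and> (\<forall>n k. xs n (x k) = (if n = k then 1 else 0))"

definition is_basis ::
    "('k::real_normed_field \<Rightarrow> 'a::real_normed_vector \<Rightarrow> 'a) \<Rightarrow> (nat \<Rightarrow> 'a) \<Rightarrow> bool" where
  "is_basis s x \<longleftrightarrow>
     closure (module.span s (range x)) = UNIV \<and>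
     (\<exists>xs. biorthogonal_functionals s x xs \<and>
           bdd_above (range (\<lambda>n. max (norm (x n)) (onorm (xs n)))))"

lemma biorthogonal_functionals_unique:
  assumes s: "normed_space_over s"
    and dense: "closure (module.span s (range x)) = UNIV"
    and xs: "biorthogonal_functionals s x xs" and ys: "biorthogonal_functionals s x ys"
  shows "xs = ys"
proof
  fix n
  interpret normed_space_over s by (rule s)
  interpret vector_space_pair s "(*) :: 'a \<Rightarrow> 'a \<Rightarrow> 'a"
    using normed_space_over_times[where 'k = 'a]
    by (intro vector_space_pair.intro vector_space_axioms) (simp add: normed_space_over_def)
  have cont: "continuous_on UNIV f" if f: "f \<in> dual_space s" for f :: "'b \<Rightarrow> 'a"
  proof -
    interpret l: Vector_Spaces.linear s "(*)" f
      using f by (simp add: dual_space_def)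
    obtain K where K: "norm (f v) \<le> K * norm v" for v
      using f by (auto simp: dual_space_def)
    have "bounded_linear f"
    proof (rule bounded_linear_intro)
      show "f (u + v) = f u + f v" for u v by (rule l.add)
      show "f (r *\<^sub>R v) = r *\<^sub>R f v" for r v
        using l.scale[of "of_real r" v] by (simp add: scale_of_real scaleR_conv_of_real)
      show "norm (f v) \<le> norm v * K" for v using K[of v] by (simp add: mult.commute)
    qed
    then show ?thesis by (simp add: linear_continuous_on)
  qed
  have d: "xs n \<in> dual_space s" "ys n \<in> dual_space s"
    using xs ys by (auto simp: biorthogonal_functionals_def)
  then have lin: "Vector_Spaces.linear s (*) (xs n)" "Vector_Spaces.linear s (*) (ys n)"
    by (auto simp: dual_space_def)
  have "span (range x) \<subseteq> {v. xs n v = ys n v}"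
  proof
    fix v assume v: "v \<in> span (range x)"
    have "xs n v = ys n v"
      by (rule linear_eq_on[OF lin v])
        (use xs ys in \<open>auto simp: biorthogonal_functionals_def\<close>)
    then show "v \<in> {v. xs n v = ys n v}" by simp
  qed
  moreover have "closed {v. xs n v = ys n v}"
    by (intro closed_Collect_eq cont d)
  ultimately have "closure (span (range x)) \<subseteq> {v. xs n v = ys n v}"
    by (rule closure_minimal)
  then show "xs n = ys n" using dense by auto
qed

definition coordinate_functionals ::
    "('k::real_normed_field \<Rightarrow> 'a::real_normed_vector \<Rightarrow> 'a) \<Rightarrow> (nat \<Rightarrow> 'a) \<Rightarrow> nat \<Rightarrow> 'a \<Rightarrow> 'k" where
  "coordinate_functionals s x = (THE xs. biorthogonal_functionals s x xs)"

lemma coordinate_functionals: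
  assumes "normed_space_over s" "is_basis s x"
  shows "biorthogonal_functionals s x (coordinate_functionals s x)"
proof -
  from assms(2) obtain xs where xs: "biorthogonal_functionals s x xs"
    and dense: "closure (module.span s (range x)) = UNIV"
    unfolding is_basis_def by blast
  show ?thesis
    unfolding coordinate_functionals_def
    by (rule theI[where P = "biorthogonal_functionals s x", OF xs]) (rule biorthogonal_functionals_unique[OF assms(1) dense _ xs])
qed

text \<open>
  The set comprehension is the linear span of the coordinate functionals; totality says that it is
  weak* dense in the dual space.
\<close>

definition markushevich_basis ::
    "('k::real_normed_field \<Rightarrow> 'a::real_normed_vector \<Rightarrow> 'a) \<Rightarrow> (nat \<Rightarrow> 'a) \<Rightarrow> bool" where
  "markushevich_basis s x \<longleftrightarrow>
     is_basis s x \<and>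
     weak_star_topology s closure_of
       {\<lambda>v. \<Sum>n\<in>A. c n * coordinate_functionals s x n v | A c. finite A} = dual_space s"

definition equivalent_seqs ::
    "('k::real_normed_field \<Rightarrow> 'a::real_normed_vector \<Rightarrow> 'a) \<Rightarrow> (nat \<Rightarrow> 'a) \<Rightarrow> (nat \<Rightarrow> 'a) \<Rightarrow> bool" where
  "equivalent_seqs s x y \<longleftrightarrow>
     (\<exists>C::real. C \<ge> 1 \<and> (\<forall>a. finite {n. a n \<noteq> 0} \<longrightarrow>
        norm (\<Sum>n | a n \<noteq> 0. s (a n) (x n)) / C \<le> norm (\<Sum>n | a n \<noteq> 0. s (a n) (y n)) \<and>
        norm (\<Sum>n | a n \<noteq> 0. s (a n) (y n)) \<le> C * norm (\<Sum>n | a n \<noteq> 0. s (a n) (x n))))"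

definition symmetric_basis ::
    "('k::real_normed_field \<Rightarrow> 'a::real_normed_vector \<Rightarrow> 'a) \<Rightarrow> (nat \<Rightarrow> 'a) \<Rightarrow> bool" where
  "symmetric_basis s x \<longleftrightarrow>
     is_basis s x \<and> (\<forall>\<pi>. bij \<pi> \<longrightarrow> equivalent_seqs s x (\<lambda>n. x (\<pi> n)))"

definition unconditional_basis ::
    "('k::real_normed_field \<Rightarrow> 'a::real_normed_vector \<Rightarrow> 'a) \<Rightarrow> (nat \<Rightarrow> 'a) \<Rightarrow> bool" where
  "unconditional_basis s x \<longleftrightarrow>
     is_basis s x \<and>
     (\<forall>v \<pi>. bij \<pi> \<longrightarrow> (\<lambda>i. s (coordinate_functionals s x (\<pi> i) v) (x (\<pi> i))) sums v)"

definition signed_indicator ::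
    "('k::real_normed_field \<Rightarrow> 'a::real_normed_vector \<Rightarrow> 'a) \<Rightarrow> (nat \<Rightarrow> 'a) \<Rightarrow> (nat \<Rightarrow> 'k) \<Rightarrow> nat set \<Rightarrow> 'a"
  where
  "signed_indicator s x \<epsilon> A = (\<Sum>n\<in>A. s (\<epsilon> n) (x n))"

definition dual_signed_indicator ::
    "('k::real_normed_field \<Rightarrow> 'a::real_normed_vector \<Rightarrow> 'a) \<Rightarrow> (nat \<Rightarrow> 'a) \<Rightarrow> (nat \<Rightarrow> 'k) \<Rightarrow> nat set \<Rightarrow>
     'a \<Rightarrow> 'k" where
  "dual_signed_indicator s x \<epsilon> A = (\<lambda>v. \<Sum>n\<in>A. \<epsilon> n * coordinate_functionals s x n v)"

definition unimodular_on :: "nat set \<Rightarrow> (nat \<Rightarrow> 'k::real_normed_field) \<Rightarrow> bool" where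
  "unimodular_on A \<epsilon> \<longleftrightarrow> (\<forall>n\<in>A. norm (\<epsilon> n) = 1)"

definition bidemocratic ::
    "('k::real_normed_field \<Rightarrow> 'a::real_normed_vector \<Rightarrow> 'a) \<Rightarrow> (nat \<Rightarrow> 'a) \<Rightarrow> bool" where
  "bidemocratic s x \<longleftrightarrow>
     (\<exists>C::real. \<forall>(m::nat) A B \<epsilon> \<delta>.
        finite A \<and> finite B \<and> max (card A) (card B) \<le> m \<and>
        unimodular_on A \<epsilon> \<and> unimodular_on B \<delta> \<longrightarrow>
        norm (signed_indicator s x \<epsilon> A) * onorm (dual_signed_indicator s x \<delta> B) \<le> C * real m)"

definition super_democratic ::
    "('k::real_normed_field \<Rightarrow> 'a::real_normed_vector \<Rightarrow> 'a) \<Rightarrow> (nat \<Rightarrow> 'a) \<Rightarrow> bool" where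
  "super_democratic s x \<longleftrightarrow>
     (\<exists>C::real. \<forall>A B \<epsilon> \<delta>.
        finite A \<and> finite B \<and> card A = card B \<and> unimodular_on A \<epsilon> \<and> unimodular_on B \<delta> \<longrightarrow>
        norm (signed_indicator s x \<epsilon> A) \<le> C * norm (signed_indicator s x \<delta> B))"

definition unconditional_for_constant_coefficients ::
    "('k::real_normed_field \<Rightarrow> 'a::real_normed_vector \<Rightarrow> 'a) \<Rightarrow> (nat \<Rightarrow> 'a) \<Rightarrow> bool" where
  "unconditional_for_constant_coefficients s x \<longleftrightarrow>
     (\<exists>C::real. \<forall>A \<epsilon> \<delta>.
        finite A \<and> unimodular_on A \<epsilon> \<and> unimodular_on A \<delta> \<longrightarrow>
        norm (signed_indicator s x \<epsilon> A) \<le> C * norm (signed_indicator s x \<delta> A))"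

definition all_equivalent :: "bool list \<Rightarrow> bool" where
  "all_equivalent Ps \<longleftrightarrow> (\<forall>P\<in>set Ps. \<forall>Q\<in>set Ps. P \<longleftrightarrow> Q)"

end

theory Submission
  imports Defs
begin

text \<open>
  All five conditions are shown to be equivalent to one more: scalar multipliers of modulus at most
  one act uniformly boundedly on finite linear combinations of the basis
  (\<open>bounded_multipliers\<close>).

  A symmetric basis is uniformly symmetric (\<open>uniformly_symmetric\<close>): otherwise finite permutations
  with disjoint supports, each violating a larger bound, combine to one permutation without a bound.
  The key observation is that differences are unconditional even when the basis is not. If \<open>\<sigma>\<close> moves
  the support of \<open>a\<close> off itself, then \<open>\<Sum>a\<^sub>n (x\<^sub>n - x\<^sub>\<sigma>\<^sub>n)\<close> is bounded by \<open>\<Sum>a\<^sub>n x\<^sub>n\<close>, and changing the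
  sign of its \<open>n\<close>-th term only swaps the indices \<open>n\<close> and \<open>\<sigma> n\<close>
  (\<open>differences_bounded_multipliers\<close>). It remains to compare a vector with its differences, and the
  growth of two sequences of norms decides how well this works.

  If the averages of the first \<open>N\<close> basis vectors come arbitrarily close to zero, then \<open>x\<^sub>n\<close> can be
  replaced by \<open>x\<^sub>n\<close> minus a small average of far away basis vectors, and the multipliers are bounded
  (\<open>bounded_multipliers_if_averages_small\<close>). If \<open>N\<close> differences always add up to a vector of norm at
  least \<open>c N\<close>, then averaging over cyclic rotations shows that the basis is equivalent to the unit
  vector basis of \<open>l\<^sub>1\<close>, and the multipliers are bounded as well
  (\<open>bounded_multipliers_if_differences_large\<close>).

  In the remaining case the sum of the first \<open>N\<close> basis vectors has norm at least \<open>c N\<close>, while \<open>N\<close>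
  differences can add up to a vector of norm much smaller than \<open>N\<close>. This is incompatible with
  unconditionality for constant coefficients, hence with super-democracy and bidemocracy. It is also
  incompatible with totality: averaging over rotations shows that the sum of the coefficients extends to a bounded
  functional \<open>f\<close>, the averages have a subsequence with a limit \<open>u\<close>, and \<open>f u = 1\<close> although every
  coordinate functional vanishes at \<open>u\<close>. A model of this case is the sequence \<open>(e\<^sub>n, 1)\<close> in
  the direct sum of \<open>l\<^sub>2\<close> and the scalar field.

  Conversely, bounded multipliers give unconditionality by density of the span, super-democracy by
  symmetry, and bidemocracy by averaging over rotations. An unconditional basis is total because the
  partial sums of the expansions make every functional a pointwise limit of combinations of
  coordinate functionals.
\<close>

section \<open>Signs, rotations and permutations\<close>

text \<open>
  The norm is convex and every point of a cube is a convex combination of its vertices. The offset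
  \<open>w\<close> holds the terms that the induction on \<open>S\<close> has already treated.
\<close>

lemma norm_le_of_signs:
  fixes v :: "'i \<Rightarrow> 'a::real_normed_vector"
  assumes "finite S"
    and "\<And>\<epsilon>. \<forall>i\<in>S. \<epsilon> i \<in> {-1, 1::real} \<Longrightarrow> norm (w + (\<Sum>i\<in>S. \<epsilon> i *\<^sub>R v i)) \<le> K"
    and "\<forall>i\<in>S. \<bar>b i\<bar> \<le> 1"
  shows "norm (w + (\<Sum>i\<in>S. b i *\<^sub>R v i)) \<le> K"
  using assms
proof (induction S arbitrary: w)
  case empty
  then show ?case by simp
next
  case (insert k F)
  let ?W = "\<lambda>t. (w + t *\<^sub>R v k) + (\<Sum>i\<in>F. b i *\<^sub>R v i)"
  have W: "norm (?W t) \<le> K" if t: "t \<in> {-1, 1}" for t :: real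
  proof (rule insert.IH)
    fix \<epsilon> :: "'i \<Rightarrow> real" assume \<epsilon>: "\<forall>i\<in>F. \<epsilon> i \<in> {-1, 1}"
    have "(\<Sum>i\<in>F. (\<epsilon>(k := t)) i *\<^sub>R v i) = (\<Sum>i\<in>F. \<epsilon> i *\<^sub>R v i)"
      by (rule sum.cong) (use insert.hyps in auto)
    moreover have "norm (w + (\<Sum>i\<in>insert k F. (\<epsilon>(k := t)) i *\<^sub>R v i)) \<le> K"
      by (rule insert.prems(1)) (use \<epsilon> t in auto)
    ultimately show "norm ((w + t *\<^sub>R v k) + (\<Sum>i\<in>F. \<epsilon> i *\<^sub>R v i)) \<le> K"
      using insert.hyps by (simp add: add.assoc)
  qed (use insert.prems in auto)
  have b: "\<bar>b k\<bar> \<le> 1" using insert.prems by auto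
  have "?W (b k) = ((1 + b k) / 2) *\<^sub>R ?W 1 + ((1 - b k) / 2) *\<^sub>R ?W (-1)"
  proof -
    have 1: "((1 + b k) / 2) *\<^sub>R u + ((1 - b k) / 2) *\<^sub>R u = u" for u :: 'a
      by (simp flip: scaleR_add_left add_divide_distrib)
    have 2: "((1 + b k) / 2) *\<^sub>R u - ((1 - b k) / 2) *\<^sub>R u = b k *\<^sub>R u" for u :: 'a
      by (simp flip: scaleR_left_diff_distrib diff_divide_distrib)
    define u where "u = w + (\<Sum>i\<in>F. b i *\<^sub>R v i)"
    have W_u: "?W t = u + t *\<^sub>R v k" for t by (simp add: u_def)
    have "((1 + b k) / 2) *\<^sub>R ?W 1 + ((1 - b k) / 2) *\<^sub>R ?W (-1)
        = (((1 + b k) / 2) *\<^sub>R u + ((1 - b k) / 2) *\<^sub>R u)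
          + (((1 + b k) / 2) *\<^sub>R v k - ((1 - b k) / 2) *\<^sub>R v k)"
      unfolding W_u by (simp add: scaleR_add_right scaleR_diff_right)
    also have "\<dots> = ?W (b k)" unfolding 1 2 W_u ..
    finally show ?thesis by (rule sym)
  qed
  then have "norm (?W (b k)) \<le> ((1 + b k) / 2) * norm (?W 1) + ((1 - b k) / 2) * norm (?W (-1))"
    using norm_triangle_ineq[of "((1 + b k) / 2) *\<^sub>R ?W 1" "((1 - b k) / 2) *\<^sub>R ?W (-1)"] b
    by simp
  also have "\<dots> \<le> ((1 + b k) / 2) * K + ((1 - b k) / 2) * K"
    by (intro add_mono mult_left_mono W) (use b in auto)
  also have "\<dots> = K" by (simp add: field_simps)
  finally show ?case using insert.hyps by (simp add: add.assoc)
qed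

text \<open>
  Place the indices of \<open>S\<close> among \<open>0, ..., N - 1\<close> and let all \<open>N\<close> rotations act. Under them each
  coefficient meets each \<open>y\<^sub>n\<close> exactly once, so the \<open>N\<close> rotated combinations add up to
  \<open>(\<Sum>a\<^sub>i) (\<Sum>y\<^sub>n)\<close>.
\<close>

lemma averaging:
  assumes s: "normed_space_over s"
    and S: "finite S" "card S \<le> N"
    and R: "\<And>p. inj_on p S \<Longrightarrow> p ` S \<subseteq> {..<N} \<Longrightarrow> norm (\<Sum>i\<in>S. s (a i) (y (p i))) \<le> R"
  shows "norm (\<Sum>i\<in>S. a i) * norm (\<Sum>n<N. y n) \<le> real N * R"
proof (cases "N = 0")
  case True
  then show ?thesis by simp
next
  case False
  interpret normed_space_over s by (rule s)
  obtain h where h: "inj_on h S" "h ` S \<subseteq> {..<N}"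
    using S card_le_inj[of S "{..<N}"] by auto
  define p where "p k i = (h i + k) mod N" for k i
  have rot: "bij_betw (\<lambda>k. (m + k) mod N) {..<N} {..<N}" for m
  proof -
    have "inj_on (\<lambda>k. (m + k) mod N) {..<N}"
    proof (rule linorder_inj_onI')
      fix k l assume kl: "l \<in> {..<N}" "k < l"
      then have "\<not> N dvd (m + l) - (m + k)" by (auto dest: dvd_imp_le)
      then show "(m + k) mod N \<noteq> (m + l) mod N"
        using kl mod_eq_dvd_iff_nat[of "m + k" "m + l" N] by auto
    qed
    moreover from this have "(\<lambda>k. (m + k) mod N) ` {..<N} = {..<N}"
      by (intro endo_inj_surj) (use False in auto)
    ultimately show ?thesis by (simp add: bij_betw_def)
  qed
  have "(\<Sum>k<N. \<Sum>i\<in>S. s (a i) (y (p k i))) = (\<Sum>i\<in>S. \<Sum>k<N. s (a i) (y (p k i)))"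
    by (rule sum.swap)
  also have "\<dots> = (\<Sum>i\<in>S. s (a i) (\<Sum>k<N. y k))"
    unfolding p_def
    by (intro sum.cong refl)
       (simp add: sum.reindex_bij_betw[OF rot, of y] flip: scale_sum_right)
  also have "\<dots> = s (\<Sum>i\<in>S. a i) (\<Sum>k<N. y k)" by (simp add: scale_sum_left)
  finally have eq: "norm (\<Sum>i\<in>S. a i) * norm (\<Sum>n<N. y n)
      = norm (\<Sum>k<N. \<Sum>i\<in>S. s (a i) (y (p k i)))"
    by (simp add: norm_scale)
  also have "\<dots> \<le> (\<Sum>k<N. R)"
  proof (rule sum_norm_le)
    fix k assume "k \<in> {..<N}"
    show "norm (\<Sum>i\<in>S. s (a i) (y (p k i))) \<le> R"
    proof (rule R)
      have "inj_on (\<lambda>m. (k + m) mod N) (h ` S)"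
        using rot[of k] h by (auto simp: bij_betw_def intro: inj_on_subset)
      then show "inj_on (p k) S"
        using h(1) comp_inj_on[of h S "\<lambda>m. (k + m) mod N"]
        by (simp add: p_def[abs_def] o_def add.commute)
      show "p k ` S \<subseteq> {..<N}" using False by (auto simp: p_def)
    qed
  qed
  finally show ?thesis by simp
qed

lemma inj_on_extends_to_permutation:
  assumes "finite S" "inj_on \<sigma> S"
  obtains \<pi> where "\<pi> permutes (S \<union> \<sigma> ` S)" "\<And>n. n \<in> S \<Longrightarrow> \<pi> n = \<sigma> n"
proof -
  let ?E = "S \<union> \<sigma> ` S"
  have "card (?E - S) = card (?E - \<sigma> ` S)"
    using assms by (simp add: card_Diff_subset card_image)
  then obtain h where h: "bij_betw h (?E - S) (?E - \<sigma> ` S)"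
    using assms by (metis finite_same_card_bij finite_Un finite_imageI finite_Diff)
  define \<pi> where "\<pi> n = (if n \<in> S then \<sigma> n else if n \<in> ?E then h n else n)" for n
  have "bij_betw \<pi> S (\<sigma> ` S)"
    using assms(2) by (auto simp: bij_betw_def \<pi>_def inj_on_def)
  moreover have "bij_betw \<pi> (?E - S) (?E - \<sigma> ` S)"
    using h by (rule bij_betw_cong[THEN iffD1, rotated]) (auto simp: \<pi>_def)
  ultimately have "bij_betw \<pi> (S \<union> (?E - S)) (\<sigma> ` S \<union> (?E - \<sigma> ` S))"
    by (rule bij_betw_combine) auto
  moreover have "S \<union> (?E - S) = ?E" "\<sigma> ` S \<union> (?E - \<sigma> ` S) = ?E" by auto
  ultimately have "bij_betw \<pi> ?E ?E" by metis
  then have "\<pi> permutes ?E"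
    by (rule bij_imp_permutes) (auto simp: \<pi>_def)
  then show thesis by (rule that) (simp add: \<pi>_def)
qed

section \<open>Symmetric bases are uniformly symmetric\<close>

text \<open>
  The element \<open>j\<close> stands for \<open>0\<close> when the scalars are real and for the imaginary unit when they are
  complex. Splitting a scalar into two real components reduces scalar multipliers to real ones, and
  so to signs, by one argument for both fields.
\<close>

locale symmetric_basis_over = normed_space_over s
  for s :: "'k::{real_normed_field,banach} \<Rightarrow> 'b::banach \<Rightarrow> 'b" +
  fixes x :: "nat \<Rightarrow> 'b" and j :: 'k
  assumes symmetric: "symmetric_basis s x"
    and components: "\<And>c. \<exists>p q. c = of_real p + of_real q * j \<and> \<bar>p\<bar> \<le> norm c \<and> \<bar>q\<bar> \<le> norm c"
    and norm_j: "norm j \<le> 1"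
begin

abbreviation "xs \<equiv> coordinate_functionals s x"

lemma basis: "is_basis s x"
  using symmetric by (simp add: symmetric_basis_def)

lemma dense: "closure (span (range x)) = UNIV"
  using basis by (simp add: is_basis_def)

lemma biorthogonal: "biorthogonal_functionals s x xs"
  by (rule coordinate_functionals[OF normed_space_over_axioms basis])

lemma xs_x: "xs n (x k) = (if n = k then 1 else 0)"
  using biorthogonal by (simp add: biorthogonal_functionals_def)

lemma xs_dual: "xs n \<in> dual_space s"
  using biorthogonal by (simp add: biorthogonal_functionals_def)

lemma dual_bounded_linear:
  assumes "f \<in> dual_space s"
  shows "bounded_linear f"
proof -
  interpret l: Vector_Spaces.linear s "(*)" f
    using assms by (simp add: dual_space_def)
  obtain K where K: "norm (f v) \<le> K * norm v" for v
    using assms by (auto simp: dual_space_def)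
  show ?thesis
  proof (rule bounded_linear_intro)
    show "f (u + v) = f u + f v" for u v by (rule l.add)
    show "f (r *\<^sub>R v) = r *\<^sub>R f v" for r v
      using l.scale[of "of_real r" v] by (simp add: scale_of_real scaleR_conv_of_real)
    show "norm (f v) \<le> norm v * K" for v using K[of v] by (simp add: mult.commute)
  qed
qed

lemma dual_scale: "f \<in> dual_space s \<Longrightarrow> f (s c v) = c * f v"
  using module_hom.scale[of s "(*)" f] by (simp add: dual_space_def linear_iff_module_hom)

lemma dual_sum: "f \<in> dual_space s \<Longrightarrow> f (\<Sum>i\<in>S. s (a i) (y i)) = (\<Sum>i\<in>S. a i * f (y i))"
  by (simp add: linear_sum[OF bounded_linear.linear[OF dual_bounded_linear]] dual_scale)

lemma xs_sum: "finite S \<Longrightarrow> xs k (\<Sum>n\<in>S. s (a n) (x n)) = (if k \<in> S then a k else 0)"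
  by (simp add: dual_sum[OF xs_dual] xs_x if_distrib[of "(*) _"] sum.delta' cong: if_cong)

lemma uniform_bound:
  obtains M :: real where "M \<ge> 1" "\<And>n. norm (x n) \<le> M" "\<And>n v. norm (xs n v) \<le> M * norm v"
proof -
  obtain ys where ys: "biorthogonal_functionals s x ys"
    and bdd: "bdd_above (range (\<lambda>n. max (norm (x n)) (onorm (ys n))))"
    using basis by (auto simp: is_basis_def)
  have eq: "ys = xs"
    by (rule biorthogonal_functionals_unique[OF normed_space_over_axioms dense ys biorthogonal])
  from bdd obtain M where M': "\<forall>r\<in>range (\<lambda>n. max (norm (x n)) (onorm (ys n))). r \<le> M"
    unfolding bdd_above_def by (rule exE)
  have M: "max (norm (x n)) (onorm (xs n)) \<le> M" for n
    using bspec[OF M' rangeI[of _ n]] eq by simp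
  show thesis
  proof (rule that[of "max 1 M"])
    show "norm (x n) \<le> max 1 M" for n using M[of n] by linarith
    show "norm (xs n v) \<le> max 1 M * norm v" for n v
    proof -
      have "norm (xs n v) \<le> onorm (xs n) * norm v"
        by (rule onorm[OF dual_bounded_linear[OF xs_dual]])
      also have "\<dots> \<le> max 1 M * norm v" using M[of n] by (intro mult_right_mono) auto
      finally show ?thesis .
    qed
  qed simp
qed

lemma permuted_bound:
  assumes "bij \<pi>"
  shows "\<exists>C\<ge>1. \<forall>S a. finite S \<longrightarrow>
    norm (\<Sum>n\<in>S. s (a n) (x (\<pi> n))) \<le> C * norm (\<Sum>n\<in>S. s (a n) (x n))"
proof -
  have "equivalent_seqs s x (\<lambda>n. x (\<pi> n))"
    using symmetric assms by (simp add: symmetric_basis_def)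
  then obtain C where "C \<ge> 1" and C: "finite {n. a n \<noteq> 0} \<Longrightarrow>
      norm (\<Sum>n | a n \<noteq> 0. s (a n) (x (\<pi> n))) \<le> C * norm (\<Sum>n | a n \<noteq> 0. s (a n) (x n))" for a
    by (auto simp: equivalent_seqs_def)
  moreover have "norm (\<Sum>n\<in>S. s (a n) (x (\<pi> n))) \<le> C * norm (\<Sum>n\<in>S. s (a n) (x n))"
    if S: "finite S" for S a
  proof -
    let ?a = "\<lambda>n. if n \<in> S then a n else 0"
    have sub: "{n. ?a n \<noteq> 0} \<subseteq> S" by auto
    have eq: "(\<Sum>n | ?a n \<noteq> 0. s (?a n) (y n)) = (\<Sum>n\<in>S. s (a n) (y n))" for y
      by (rule sum.mono_neutral_cong_left) (use S sub in auto)
    show ?thesis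
      using C[of ?a] finite_subset[OF sub S] by (simp only: eq)
  qed
  ultimately show ?thesis by blast
qed

text \<open>
  A gliding hump. If no finite set \<open>F\<close> works, one finds finite sets \<open>E\<^sub>0, E\<^sub>1, ...\<close>, each disjoint
  from the earlier ones, and permutations \<open>P\<^sub>k\<close> of \<open>E\<^sub>k\<close> that violate the bound with constant \<open>k\<close>.
  The permutation that equals \<open>P\<^sub>k\<close> on each \<open>E\<^sub>k\<close> then yields a sequence that is not equivalent to
  the basis.
\<close>

lemma permuted_bound_off_finite_set:
  "\<exists>F C. finite F \<and> (\<forall>E \<pi> a. finite E \<longrightarrow> E \<inter> F = {} \<longrightarrow> \<pi> permutes E \<longrightarrow>
     norm (\<Sum>n\<in>E. s (a n) (x (\<pi> n))) \<le> C * norm (\<Sum>n\<in>E. s (a n) (x n)))"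
proof (rule ccontr)
  assume neg: "\<not> ?thesis"
  define bad where "bad F k E \<pi> a \<longleftrightarrow> finite E \<and> E \<inter> F = {} \<and> \<pi> permutes E \<and>
      real k * norm (\<Sum>n\<in>E. s (a n) (x n)) < norm (\<Sum>n\<in>E. s (a n) (x (\<pi> n)))"
    for F E :: "nat set" and k :: nat and \<pi> :: "nat \<Rightarrow> nat" and a :: "nat \<Rightarrow> 'k"
  have ex: "\<exists>E \<pi> a. bad F k E \<pi> a" if "finite F" for F k
  proof (rule ccontr)
    assume "\<nexists>E \<pi> a. bad F k E \<pi> a"
    then have "finite F \<and> (\<forall>E \<pi> a. finite E \<longrightarrow> E \<inter> F = {} \<longrightarrow> \<pi> permutes E \<longrightarrow>
        norm (\<Sum>n\<in>E. s (a n) (x (\<pi> n))) \<le> real k * norm (\<Sum>n\<in>E. s (a n) (x n)))"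
      using that by (simp add: bad_def not_less)
    then have "\<exists>F C. finite F \<and> (\<forall>E \<pi> a. finite E \<longrightarrow> E \<inter> F = {} \<longrightarrow> \<pi> permutes E \<longrightarrow>
        norm (\<Sum>n\<in>E. s (a n) (x (\<pi> n))) \<le> C * norm (\<Sum>n\<in>E. s (a n) (x n)))"
      by (intro exI)
    with neg show False by (rule notE)
  qed
  (* F k collects the blocks before the k-th one; E k, P k and a k are the block avoiding F k,
     its permutation and the coefficients that violate the bound. *)
  define e where "e F k = (SOME E. \<exists>\<pi> a. bad F k E \<pi> a)" for F k
  define F where "F = rec_nat {} (\<lambda>k F. F \<union> e F k)"
  define E where "E k = e (F k) k" for k
  define P where "P k = (SOME \<pi>. \<exists>a. bad (F k) k (E k) \<pi> a)" for k
  define a where "a k = (SOME a. bad (F k) k (E k) (P k) a)" for k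
  have F_Suc: "F (Suc k) = F k \<union> E k" and F_0: "F 0 = {}" for k
    by (simp_all add: F_def E_def)
  have block: "finite (E k) \<and> E k \<inter> F k = {} \<and> P k permutes E k \<and>
      real k * norm (\<Sum>n\<in>E k. s (a k n) (x n)) < norm (\<Sum>n\<in>E k. s (a k n) (x (P k n)))"
    if "finite (F k)" for k
  proof -
    have "\<exists>\<pi> a. bad (F k) k (E k) \<pi> a"
      unfolding E_def e_def by (rule someI_ex) (rule ex[OF that])
    then have "\<exists>a. bad (F k) k (E k) (P k) a"
      unfolding P_def by (rule someI_ex)
    then have "bad (F k) k (E k) (P k) (a k)"
      unfolding a_def by (rule someI_ex)
    then show ?thesis by (simp add: bad_def)
  qed
  have finF: "finite (F k)" for k
    by (induction k) (use block in \<open>auto simp: F_0 F_Suc\<close>)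
  note block = block[OF finF]
  have F_mono: "F k \<subseteq> F l" if "k \<le> l" for k l
    using lift_Suc_mono_le[of F, OF _ that] by (auto simp: F_Suc)
  have disj: "E k \<inter> E l = {}" if "k < l" for k l
    using block[of l] F_mono[of "Suc k" l] that by (auto simp: F_Suc)
  have same: "k = l" if "n \<in> E k" "n \<in> E l" for n k l
    using disj[of k l] disj[of l k] that by (cases k l rule: linorder_cases) auto
  define \<pi> where "\<pi> n = (if \<exists>k. n \<in> E k then P (THE k. n \<in> E k) n else n)" for n
  have \<pi>_E: "\<pi> n = P k n" if "n \<in> E k" for n k
  proof -
    have "(THE k. n \<in> E k) = k" using that same by blast
    then show ?thesis using that by (auto simp: \<pi>_def)
  qed
  have \<pi>_out: "\<pi> n = n" if "\<And>k. n \<notin> E k" for n using that by (simp add: \<pi>_def)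
  have P_in: "P k n \<in> E k \<longleftrightarrow> n \<in> E k" for k n using block[of k] permutes_in_image by metis
  have \<pi>_in: "\<pi> n \<in> E k \<longleftrightarrow> n \<in> E k" for n k
    by (metis P_in \<pi>_E \<pi>_out same)
  have bij: "bij \<pi>"
  proof (rule bijI)
    show "inj \<pi>"
    proof (rule injI)
      fix m n assume eq: "\<pi> m = \<pi> n"
      show "m = n"
      proof (cases "\<exists>k. m \<in> E k")
        case True
        then obtain k where k: "m \<in> E k" by blast
        then have "n \<in> E k" using eq \<pi>_in by metis
        then have "P k m = P k n" using k eq \<pi>_E by metis
        then show ?thesis using block[of k] permutes_inj by (metis injD)
      next
        case False
        then have "\<And>k. n \<notin> E k" using eq \<pi>_in by metis
        then show ?thesis using False eq \<pi>_out by metis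
      qed
    qed
    show "surj \<pi>"
      unfolding surj_def
    proof
      fix n
      show "\<exists>m. n = \<pi> m"
      proof (cases "\<exists>k. n \<in> E k")
        case True
        then obtain k where k: "n \<in> E k" by blast
        have "P k ` E k = E k" using block[of k] by (simp add: permutes_image)
        with k obtain m where "n = P k m" "m \<in> E k" by (metis imageE)
        then show ?thesis by (intro exI[of _ m]) (simp add: \<pi>_E)
      next
        case False
        then show ?thesis using \<pi>_out[of n] by metis
      qed
    qed
  qed
  obtain C where C: "\<forall>S a. finite S \<longrightarrow>
      norm (\<Sum>n\<in>S. s (a n) (x (\<pi> n))) \<le> C * norm (\<Sum>n\<in>S. s (a n) (x n))"
    using permuted_bound[OF bij] by (elim exE conjE)
  obtain k :: nat where k: "C \<le> real k" using real_arch_simple by blast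
  have "(\<Sum>n\<in>E k. s (a k n) (x (\<pi> n))) = (\<Sum>n\<in>E k. s (a k n) (x (P k n)))"
    by (rule sum.cong) (simp_all add: \<pi>_E)
  then have "norm (\<Sum>n\<in>E k. s (a k n) (x (P k n))) \<le> C * norm (\<Sum>n\<in>E k. s (a k n) (x n))"
    using C[THEN spec, THEN spec, of "E k" "a k"] block[of k] by simp
  also have "\<dots> \<le> real k * norm (\<Sum>n\<in>E k. s (a k n) (x n))"
    by (intro mult_right_mono k) simp
  finally show False using block[of k] by linarith
qed

text \<open>
  An injection of a finite set extends to a finite permutation, and its domain and range avoid the
  exceptional set \<open>F\<close> after at most \<open>2 card F\<close> coefficients are removed. Each of these is bounded by
  a coordinate functional, so their removal costs only a constant factor.
\<close>

lemma uniformly_symmetric_nat: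
  "\<exists>C\<ge>1. \<forall>S \<sigma> a. finite S \<longrightarrow> inj_on \<sigma> S \<longrightarrow>
     norm (\<Sum>n\<in>S. s (a n) (x (\<sigma> n))) \<le> C * norm (\<Sum>n\<in>S. s (a n) (x n))"
proof -
  obtain F C where F: "finite F" and C0: "\<And>E \<pi> a. finite E \<Longrightarrow> E \<inter> F = {} \<Longrightarrow> \<pi> permutes E \<Longrightarrow>
     norm (\<Sum>n\<in>E. s (a n) (x (\<pi> n))) \<le> C * norm (\<Sum>n\<in>E. s (a n) (x n))"
    using permuted_bound_off_finite_set by blast
  define B where "B = max C 0"
  have B: "norm (\<Sum>n\<in>E. s (a n) (x (\<pi> n))) \<le> B * norm (\<Sum>n\<in>E. s (a n) (x n))"
    if "finite E" "E \<inter> F = {}" "\<pi> permutes E" for E \<pi> a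
    using C0[OF that, of a] mult_right_mono[of C B "norm (\<Sum>n\<in>E. s (a n) (x n))"]
    by (simp add: B_def)
  obtain M where M: "M \<ge> 1" "\<And>n. norm (x n) \<le> M" "\<And>n v. norm (xs n v) \<le> M * norm v"
    using uniform_bound by blast
  define D where "D = 2 * real (card F) * M\<^sup>2"
  have "norm (\<Sum>n\<in>S. s (a n) (x (\<sigma> n))) \<le> (1 + D + B * (1 + D)) * norm (\<Sum>n\<in>S. s (a n) (x n))"
    if S: "finite S" and \<sigma>: "inj_on \<sigma> S" for S \<sigma> a
  proof -
    define W where "W = (\<Sum>n\<in>S. s (a n) (x n))"
    have a_le: "norm (a n) \<le> M * norm W" if "n \<in> S" for n
      using M(3)[of n W] that S by (simp add: W_def xs_sum)
    define G where "G = {n\<in>S. n \<in> F \<or> \<sigma> n \<in> F}"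
    have "card {n\<in>S. \<sigma> n \<in> F} \<le> card F"
      by (rule card_inj_on_le[of \<sigma>]) (use \<sigma> F in \<open>auto intro: inj_on_subset\<close>)
    moreover have "card (S \<inter> F) \<le> card F" by (rule card_mono) (use F in auto)
    moreover have "G = {n\<in>S. \<sigma> n \<in> F} \<union> (S \<inter> F)" by (auto simp: G_def)
    ultimately have "card G \<le> 2 * card F"
      using card_Un_le[of "{n\<in>S. \<sigma> n \<in> F}" "S \<inter> F"] by simp
    then have card_G: "real (card G) \<le> 2 * real (card F)" by linarith
    have small: "norm (\<Sum>n\<in>G. s (a n) (x (p n))) \<le> D * norm W" for p
    proof -
      have "norm (\<Sum>n\<in>G. s (a n) (x (p n))) \<le> (\<Sum>n\<in>G. M * norm W * M)"
        by (rule sum_norm_le) (use M(1,2) a_le in \<open>auto simp: norm_scale G_def intro!: mult_mono\<close>)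
      also have "\<dots> = real (card G) * (M\<^sup>2 * norm W)" by (simp add: power2_eq_square)
      also have "\<dots> \<le> (2 * real (card F)) * (M\<^sup>2 * norm W)"
        by (intro mult_right_mono card_G) simp
      finally show ?thesis by (simp add: D_def mult.assoc)
    qed
    define T where "T = S - G"
    have T: "finite T" "inj_on \<sigma> T" using S \<sigma> by (auto simp: T_def intro: inj_on_subset)
    have split: "(\<Sum>n\<in>S. s (a n) (y n)) = (\<Sum>n\<in>T. s (a n) (y n)) + (\<Sum>n\<in>G. s (a n) (y n))" for y
      unfolding T_def by (rule sum.subset_diff) (use S in \<open>auto simp: G_def\<close>)
    obtain \<pi> where \<pi>: "\<pi> permutes (T \<union> \<sigma> ` T)" "\<And>n. n \<in> T \<Longrightarrow> \<pi> n = \<sigma> n"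
      using inj_on_extends_to_permutation[OF T] by blast
    let ?a = "\<lambda>n. if n \<in> T then a n else 0"
    have ext: "(\<Sum>n\<in>T \<union> \<sigma> ` T. s (?a n) (y n)) = (\<Sum>n\<in>T. s (a n) (y n))" for y
      by (rule sum.mono_neutral_cong_right) (use T in auto)
    have "norm (\<Sum>n\<in>T \<union> \<sigma> ` T. s (?a n) (x (\<pi> n)))
        \<le> B * norm (\<Sum>n\<in>T \<union> \<sigma> ` T. s (?a n) (x n))"
      by (rule B) (use T \<pi> in \<open>auto simp: T_def G_def\<close>)
    moreover have "(\<Sum>n\<in>T. s (a n) (x (\<pi> n))) = (\<Sum>n\<in>T. s (a n) (x (\<sigma> n)))"
      by (rule sum.cong) (simp_all add: \<pi>)
    ultimately have main: "norm (\<Sum>n\<in>T. s (a n) (x (\<sigma> n))) \<le> B * norm (\<Sum>n\<in>T. s (a n) (x n))"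
      by (simp only: ext)
    have "(\<Sum>n\<in>T. s (a n) (x n)) = W - (\<Sum>n\<in>G. s (a n) (x n))" using split[of x] by (simp add: W_def)
    then have "norm (\<Sum>n\<in>T. s (a n) (x n)) \<le> norm W + D * norm W"
      using norm_triangle_ineq4[of W "\<Sum>n\<in>G. s (a n) (x n)"] small[of "\<lambda>n. n"] by simp
    then have "B * norm (\<Sum>n\<in>T. s (a n) (x n)) \<le> B * (norm W + D * norm W)"
      by (rule mult_left_mono) (simp add: B_def)
    then have "norm (\<Sum>n\<in>S. s (a n) (x (\<sigma> n))) \<le> B * (norm W + D * norm W) + D * norm W"
      using main small[of \<sigma>]
        norm_triangle_ineq[of "\<Sum>n\<in>T. s (a n) (x (\<sigma> n))" "\<Sum>n\<in>G. s (a n) (x (\<sigma> n))"]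
      unfolding split[of "\<lambda>n. x (\<sigma> n)"] by linarith
    also have "\<dots> \<le> (1 + D + B * (1 + D)) * norm W" by (simp add: algebra_simps)
    finally show ?thesis by (simp add: W_def)
  qed
  moreover have "1 + D + B * (1 + D) \<ge> 1"
    using M(1) by (simp add: D_def B_def)
  ultimately show ?thesis by blast
qed

text \<open>
  A fixed choice of the constant makes the following bounds available for index sets of any type.
\<close>

definition symmetry_constant :: real where
  "symmetry_constant = (SOME C. C \<ge> 1 \<and> (\<forall>S \<sigma> a. finite S \<longrightarrow> inj_on \<sigma> S \<longrightarrow>
     norm (\<Sum>n\<in>S. s (a n) (x (\<sigma> n))) \<le> C * norm (\<Sum>n\<in>S. s (a n) (x n))))"

abbreviation "C \<equiv> symmetry_constant"

lemma C_ge_1: "C \<ge> 1"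
  and C_nat: "finite S \<Longrightarrow> inj_on \<sigma> S \<Longrightarrow>
     norm (\<Sum>n\<in>S. s (a n) (x (\<sigma> n))) \<le> C * norm (\<Sum>n\<in>S. s (a n) (x n))"
proof -
  have "C \<ge> 1 \<and> (\<forall>S \<sigma> a. finite S \<longrightarrow> inj_on \<sigma> S \<longrightarrow>
     norm (\<Sum>n\<in>S. s (a n) (x (\<sigma> n))) \<le> C * norm (\<Sum>n\<in>S. s (a n) (x n)))"
    unfolding symmetry_constant_def by (rule someI_ex) (use uniformly_symmetric_nat in auto)
  then show "C \<ge> 1" "finite S \<Longrightarrow> inj_on \<sigma> S \<Longrightarrow>
     norm (\<Sum>n\<in>S. s (a n) (x (\<sigma> n))) \<le> C * norm (\<Sum>n\<in>S. s (a n) (x n))" by auto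
qed

lemma uniformly_symmetric:
  assumes "finite I" "inj_on p I" "inj_on q I"
  shows "norm (\<Sum>i\<in>I. s (a i) (x (p i))) \<le> C * norm (\<Sum>i\<in>I. s (a i) (x (q i)))"
proof -
  let ?q = "inv_into I q"
  have "norm (\<Sum>n\<in>q ` I. s (a (?q n)) (x (p (?q n)))) \<le> C * norm (\<Sum>n\<in>q ` I. s (a (?q n)) (x n))"
  proof (rule C_nat)
    show "inj_on (\<lambda>n. p (?q n)) (q ` I)"
      using assms by (auto simp: inj_on_def)
  qed (use assms in simp)
  then show ?thesis using assms by (simp add: sum.reindex inv_into_f_f)
qed

text \<open>
  A combination of differences is a combination of basis vectors indexed by \<open>I \<times> UNIV\<close>, where the
  boolean component selects the positive or the negative vector of each difference.
\<close>

lemma uniformly_symmetric_differences: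
  fixes I :: "'i set"
  assumes I: "finite I"
    and p: "inj_on p I" "inj_on p' I" "p ` I \<inter> p' ` I = {}"
    and q: "inj_on q I" "inj_on q' I" "q ` I \<inter> q' ` I = {}"
  shows "norm (\<Sum>i\<in>I. s (a i) (x (p i) - x (p' i))) \<le> C * norm (\<Sum>i\<in>I. s (a i) (x (q i) - x (q' i)))"
proof -
  define sg :: "bool \<Rightarrow> 'k" where "sg t = (if t then 1 else -1)" for t
  define P where "P r r' = (\<lambda>(i, t). if t then r i else r' i)" for r r' :: "'i \<Rightarrow> nat"
  have inj: "inj_on (P r r') (I \<times> UNIV)" if "inj_on r I" "inj_on r' I" "r ` I \<inter> r' ` I = {}" for r r'
    using that by (auto simp: inj_on_def P_def split: if_splits)
  have eq: "(\<Sum>z\<in>I \<times> UNIV. s (case z of (i, t) \<Rightarrow> sg t * a i) (x (P r r' z)))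
      = (\<Sum>i\<in>I. s (a i) (x (r i) - x (r' i)))" for r r'
  proof -
    have "(\<Sum>z\<in>I \<times> UNIV. s (case z of (i, t) \<Rightarrow> sg t * a i) (x (P r r' z)))
      = (\<Sum>(i, t)\<in>I \<times> UNIV. s (sg t * a i) (x (P r r' (i, t))))"
      by (rule sum.cong) auto
    also have "\<dots> = (\<Sum>i\<in>I. \<Sum>t\<in>UNIV. s (sg t * a i) (x (P r r' (i, t))))"
      by (rule sum.cartesian_product[symmetric])
    also have "\<dots> = (\<Sum>i\<in>I. s (a i) (x (r i) - x (r' i)))"
      by (rule sum.cong) (simp_all add: UNIV_bool sg_def P_def scale_right_diff_distrib)
    finally show ?thesis .
  qed
  have "norm (\<Sum>z\<in>I \<times> UNIV. s (case z of (i, t) \<Rightarrow> sg t * a i) (x (P p p' z)))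
      \<le> C * norm (\<Sum>z\<in>I \<times> UNIV. s (case z of (i, t) \<Rightarrow> sg t * a i) (x (P q q' z)))"
    by (rule uniformly_symmetric) (use I inj[OF p] inj[OF q] in simp_all)
  then show ?thesis by (simp only: eq)
qed

section \<open>Bounded multipliers\<close>

definition bounded_multipliers :: bool where
  "bounded_multipliers \<longleftrightarrow> (\<exists>K. \<forall>S a b. finite S \<longrightarrow> (\<forall>n\<in>S. norm (b n) \<le> 1) \<longrightarrow>
     norm (\<Sum>n\<in>S. s (b n * a n) (x n)) \<le> K * norm (\<Sum>n\<in>S. s (a n) (x n)))"

lemma norm_multiplier_le_of_signs:
  assumes S: "finite S"
    and signs: "\<And>\<epsilon>. \<forall>i\<in>S. \<epsilon> i \<in> {-1, 1::real} \<Longrightarrow> norm (\<Sum>i\<in>S. \<epsilon> i *\<^sub>R v i) \<le> K"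
    and b: "\<forall>i\<in>S. norm (b i) \<le> 1"
  shows "norm (\<Sum>i\<in>S. s (b i) (v i)) \<le> 2 * K"
proof -
  have "\<forall>i. \<exists>p q. b i = of_real p + of_real q * j \<and> \<bar>p\<bar> \<le> norm (b i) \<and> \<bar>q\<bar> \<le> norm (b i)"
    using components by blast
  then obtain p q where pq: "\<And>i. b i = of_real (p i) + of_real (q i) * j"
      "\<And>i. \<bar>p i\<bar> \<le> norm (b i)" "\<And>i. \<bar>q i\<bar> \<le> norm (b i)"
    by metis
  have le: "norm (\<Sum>i\<in>S. r i *\<^sub>R v i) \<le> K" if r: "\<And>i. \<bar>r i\<bar> \<le> norm (b i)" for r :: "_ \<Rightarrow> real"
  proof -
    have "\<forall>i\<in>S. \<bar>r i\<bar> \<le> 1" using r b by (meson order_trans)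
    then show ?thesis
      using norm_le_of_signs[OF S, of 0 v K r] signs by simp
  qed
  have "s (b i) (v i) = p i *\<^sub>R v i + s j (q i *\<^sub>R v i)" for i
    by (simp add: pq(1) scale_left_distrib scale_of_real mult.commute[of _ j] flip: scale_scale)
  then have "(\<Sum>i\<in>S. s (b i) (v i)) = (\<Sum>i\<in>S. p i *\<^sub>R v i) + s j (\<Sum>i\<in>S. q i *\<^sub>R v i)"
    by (simp add: sum.distrib scale_sum_right)
  then have "norm (\<Sum>i\<in>S. s (b i) (v i))
      \<le> norm (\<Sum>i\<in>S. p i *\<^sub>R v i) + norm j * norm (\<Sum>i\<in>S. q i *\<^sub>R v i)"
    using norm_triangle_ineq by (metis norm_scale)
  also have "\<dots> \<le> K + 1 * K"
    using le[OF pq(2)] le[OF pq(3)] norm_j by (intro add_mono mult_mono) auto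
  finally show ?thesis by simp
qed

text \<open>
  Changing the sign of \<open>x\<^sub>n - x\<^sub>\<sigma>\<^sub>n\<close> amounts to swapping \<open>n\<close> and \<open>\<sigma> n\<close>, which symmetry controls. So
  the differences are unconditional, and they are themselves bounded by the original combination
  because \<open>\<Sum>a\<^sub>n x\<^sub>\<sigma>\<^sub>n\<close> is.
\<close>

lemma differences_bounded_multipliers:
  assumes S: "finite S" and \<sigma>: "inj_on \<sigma> S" "S \<inter> \<sigma> ` S = {}" and b: "\<forall>n\<in>S. norm (b n) \<le> 1"
  shows "norm (\<Sum>n\<in>S. s (b n * a n) (x n - x (\<sigma> n)))
    \<le> 2 * (C * (1 + C)) * norm (\<Sum>n\<in>S. s (a n) (x n))"
proof -
  let ?W = "\<Sum>n\<in>S. s (a n) (x n)"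
  let ?v = "\<lambda>n. s (a n) (x n - x (\<sigma> n))"
  have "norm (\<Sum>n\<in>S. \<epsilon> n *\<^sub>R ?v n) \<le> C * (1 + C) * norm ?W"
    if \<epsilon>: "\<forall>n\<in>S. \<epsilon> n \<in> {-1, 1::real}" for \<epsilon>
  proof -
    define p where "p n = (if \<epsilon> n = 1 then n else \<sigma> n)" for n
    define p' where "p' n = (if \<epsilon> n = 1 then \<sigma> n else n)" for n
    have "(\<Sum>n\<in>S. \<epsilon> n *\<^sub>R ?v n) = (\<Sum>n\<in>S. s (a n) (x (p n) - x (p' n)))"
      by (rule sum.cong) (use \<epsilon> in \<open>auto simp: p_def p'_def scale_right_diff_distrib\<close>)
    moreover have "norm (\<Sum>n\<in>S. s (a n) (x (p n) - x (p' n))) \<le> C * norm (\<Sum>n\<in>S. ?v n)"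
    proof (rule uniformly_symmetric_differences)
      have disj: "m \<noteq> \<sigma> n" if "m \<in> S" "n \<in> S" for m n using \<sigma>(2) that by blast
      have inj: "\<sigma> m = \<sigma> n \<longleftrightarrow> m = n" if "m \<in> S" "n \<in> S" for m n
        using \<sigma>(1) that by (auto dest: inj_onD)
      show "inj_on p S" "inj_on p' S"
        using disj inj disj[symmetric] by (auto simp: inj_on_def p_def p'_def split: if_splits)
      show "p ` S \<inter> p' ` S = {}"
      proof -
        have "p m \<noteq> p' n" if "m \<in> S" "n \<in> S" for m n
          using disj[OF that] disj[OF that(2,1)] inj[OF that] by (auto simp: p_def p'_def)
        then show ?thesis by blast
      qed
    qed (use S \<sigma> in auto)
    moreover have "norm (\<Sum>n\<in>S. ?v n) \<le> norm ?W + C * norm ?W"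
    proof -
      have "(\<Sum>n\<in>S. ?v n) = ?W - (\<Sum>n\<in>S. s (a n) (x (\<sigma> n)))"
        by (simp add: scale_right_diff_distrib sum_subtractf)
      then show ?thesis
        using norm_triangle_ineq4[of ?W "\<Sum>n\<in>S. s (a n) (x (\<sigma> n))"] C_nat[OF S \<sigma>(1), of a] by simp
    qed
    then have "C * norm (\<Sum>n\<in>S. ?v n) \<le> C * (norm ?W + C * norm ?W)"
      using C_ge_1 by (intro mult_left_mono) auto
    ultimately show ?thesis by (simp add: algebra_simps)
  qed
  from norm_multiplier_le_of_signs[OF S this b] show ?thesis by (simp add: mult.assoc)
qed

section \<open>Growth of the sums of basis vectors\<close>

text \<open>
  Subtract from each \<open>x\<^sub>n\<close> the average of \<open>N\<close> vectors \<open>x\<^sub>\<sigma>\<^sub>k\<^sub>n\<close> whose indices lie outside \<open>S\<close>. The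
  result is an average of combinations of differences, for which multipliers are bounded. By symmetry
  the subtracted averages are as small as that of the first \<open>N\<close> basis vectors.
\<close>

lemma bounded_multipliers_if_averages_small:
  assumes small: "\<And>e. e > 0 \<Longrightarrow> \<exists>N\<ge>1. norm (\<Sum>n<N. x n) \<le> e * real N"
  shows bounded_multipliers
proof -
  define K where "K = 2 * (C * (1 + C))"
  have "norm (\<Sum>n\<in>S. s (b n * a n) (x n)) \<le> K * norm (\<Sum>n\<in>S. s (a n) (x n))"
    if S: "finite S" and b: "\<forall>n\<in>S. norm (b n) \<le> 1" for S a b
  proof (rule field_le_epsilon)
    fix e :: real assume e: "e > 0"
    let ?W = "\<Sum>n\<in>S. s (a n) (x n)" and ?Z = "\<Sum>n\<in>S. s (b n * a n) (x n)"
    (* By symmetry, the subtracted averages contribute at most t C times the norm of the average of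
       the first N basis vectors; N is chosen to make this less than e, with t + 1 to avoid dividing
       by zero. *)
    define t where "t = (\<Sum>n\<in>S. norm (b n * a n))"
    have t: "t \<ge> 0" by (simp add: t_def sum_nonneg)
    have "e / (C * (t + 1)) > 0" using e t C_ge_1 by simp
    then obtain N where N: "N \<ge> 1" "norm (\<Sum>n<N. x n) \<le> e / (C * (t + 1)) * real N"
      using small by blast
    obtain m where m: "S \<subseteq> {..<m}" using S finite_nat_bounded by blast
    (* The shifts move S beyond its bound m, and for fixed n their values are distinct. *)
    define \<sigma> where "\<sigma> k n = n + Suc k * Suc m" for k n
    have "real N *\<^sub>R ?Z = (\<Sum>k<N. \<Sum>n\<in>S. s (b n * a n) (x n))"
      by (simp add: scaleR_conv_of_real sum_constant_scaleR)
    also have "\<dots> = (\<Sum>k<N. \<Sum>n\<in>S. s (b n * a n) (x n - x (\<sigma> k n)))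
        + (\<Sum>k<N. \<Sum>n\<in>S. s (b n * a n) (x (\<sigma> k n)))"
      by (simp add: scale_right_diff_distrib sum_subtractf)
    also have "(\<Sum>k<N. \<Sum>n\<in>S. s (b n * a n) (x (\<sigma> k n)))
        = (\<Sum>n\<in>S. s (b n * a n) (\<Sum>k<N. x (\<sigma> k n)))"
      by (subst sum.swap) (simp add: scale_sum_right)
    finally have split: "real N *\<^sub>R ?Z = (\<Sum>k<N. \<Sum>n\<in>S. s (b n * a n) (x n - x (\<sigma> k n)))
        + (\<Sum>n\<in>S. s (b n * a n) (\<Sum>k<N. x (\<sigma> k n)))" .
    have "norm (\<Sum>k<N. \<Sum>n\<in>S. s (b n * a n) (x n - x (\<sigma> k n))) \<le> (\<Sum>k<N. K * norm ?W)"
    proof (rule sum_norm_le)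
      fix k
      show "norm (\<Sum>n\<in>S. s (b n * a n) (x n - x (\<sigma> k n))) \<le> K * norm ?W"
        unfolding K_def
        by (rule differences_bounded_multipliers) (use S b m in \<open>auto simp: \<sigma>_def inj_on_def\<close>)
    qed
    moreover have "norm (\<Sum>n\<in>S. s (b n * a n) (\<Sum>k<N. x (\<sigma> k n)))
        \<le> (\<Sum>n\<in>S. norm (b n * a n) * (e / (t + 1) * real N))"
    proof (rule sum_norm_le)
      fix n
      have "norm (\<Sum>k<N. s 1 (x (\<sigma> k n))) \<le> C * norm (\<Sum>k<N. s 1 (x k))"
        by (rule uniformly_symmetric) (simp_all add: \<sigma>_def inj_on_def del: mult_Suc mult_Suc_right)
      also have "\<dots> \<le> C * (e / (C * (t + 1)) * real N)"
        using N C_ge_1 by (intro mult_left_mono) auto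
      also have "\<dots> = e / (t + 1) * real N" using C_ge_1 by simp
      finally show "norm (s (b n * a n) (\<Sum>k<N. x (\<sigma> k n)))
          \<le> norm (b n * a n) * (e / (t + 1) * real N)"
        unfolding norm_scale by (intro mult_left_mono) auto
    qed
    moreover have "(\<Sum>n\<in>S. norm (b n * a n) * (e / (t + 1) * real N)) = t * (e / (t + 1) * real N)"
      by (simp only: t_def sum_distrib_right)
    moreover have "t * (e / (t + 1) * real N) \<le> e * real N"
      using t e by (simp add: field_simps)
    ultimately have "norm (real N *\<^sub>R ?Z) \<le> real N * (K * norm ?W) + e * real N"
      unfolding split using norm_triangle_ineq[of
          "\<Sum>k<N. \<Sum>n\<in>S. s (b n * a n) (x n - x (\<sigma> k n))"
          "\<Sum>n\<in>S. s (b n * a n) (\<Sum>k<N. x (\<sigma> k n))"] by simp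
    then have "real N * norm ?Z \<le> real N * (K * norm ?W + e)" by (simp add: algebra_simps)
    then show "norm ?Z \<le> K * norm ?W + e" using N by simp
  qed
  then show ?thesis unfolding bounded_multipliers_def by blast
qed

text \<open>
  Bounded multipliers for differences allow the coefficients \<open>a\<^sub>n\<close> to be replaced by their moduli.
  Averaging over rotations then bounds \<open>\<Sum>|a\<^sub>n|\<close> times the norm of the sum of \<open>card S\<close> differences, so
  \<open>\<Sum>|a\<^sub>n|\<close> is at most a multiple of the norm of \<open>\<Sum>a\<^sub>n x\<^sub>n\<close>. No multiplier of modulus at most
  one increases that sum.
\<close>

lemma bounded_multipliers_if_differences_large:
  assumes c: "c > 0" and large: "\<And>N. c * real N \<le> norm (\<Sum>n<N. x n - x (n + N))"
  shows bounded_multipliers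
proof -
  obtain M where M: "M \<ge> 1" "\<And>n. norm (x n) \<le> M"
    using uniform_bound by metis
  define K where "K = C * (2 * (C * (1 + C)))"
  have "norm (\<Sum>n\<in>S. s (b n * a n) (x n)) \<le> (M * K / c) * norm (\<Sum>n\<in>S. s (a n) (x n))"
    if S: "finite S" and b: "\<forall>n\<in>S. norm (b n) \<le> 1" for S a b
  proof (cases "S = {}")
    case True
    then show ?thesis by simp
  next
    case False
    let ?W = "\<Sum>n\<in>S. s (a n) (x n)"
    define N where "N = card S"
    have N: "N > 0" using S False by (simp add: N_def card_gt_0_iff)
    obtain m where m: "S \<subseteq> {..<m}" using S finite_nat_bounded by blast
    (* Multiplication by d turns each coefficient into its modulus. *)
    define d where "d n = (if a n = 0 then 1 else of_real (norm (a n)) / a n)" for n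
    have d: "norm (d n) \<le> 1" "d n * a n = of_real (norm (a n))" for n
      by (simp_all add: d_def norm_divide)
    have "norm (\<Sum>n\<in>S. of_real (norm (a n)) :: 'k) * norm (\<Sum>n<N. x n - x (n + N))
        \<le> real N * (K * norm ?W)"
    proof (rule averaging[OF normed_space_over_axioms S])
      fix p assume p: "inj_on p S" "p ` S \<subseteq> {..<N}"
      have "norm (\<Sum>n\<in>S. s (d n * a n) (x (p n) - x (p n + N)))
          \<le> C * norm (\<Sum>n\<in>S. s (d n * a n) (x n - x (n + m)))"
      proof (rule uniformly_symmetric_differences)
        show "inj_on (\<lambda>n. p n + N) S" "inj_on (\<lambda>n. n) S" "inj_on (\<lambda>n. n + m) S"
          using p(1) by (auto simp: inj_on_def)
        show "p ` S \<inter> (\<lambda>n. p n + N) ` S = {}" "(\<lambda>n. n) ` S \<inter> (\<lambda>n. n + m) ` S = {}"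
          using p(2) m by fastforce+
      qed (use S p in auto)
      also have "\<dots> \<le> C * (2 * (C * (1 + C)) * norm ?W)"
      proof (intro mult_left_mono differences_bounded_multipliers)
        show "S \<inter> (\<lambda>n. n + m) ` S = {}" using m by fastforce
      qed (use S C_ge_1 d(1) in \<open>auto simp: inj_on_def\<close>)
      finally show "norm (\<Sum>n\<in>S. s (of_real (norm (a n))) (x (p n) - x (p n + N))) \<le> K * norm ?W"
        by (simp add: d K_def mult.assoc)
    qed (simp add: N_def)
    moreover have "norm (\<Sum>n\<in>S. of_real (norm (a n)) :: 'k) = (\<Sum>n\<in>S. norm (a n))"
      by (simp add: sum_nonneg flip: of_real_sum)
    moreover have "(\<Sum>n\<in>S. norm (a n)) * (c * real N)
        \<le> (\<Sum>n\<in>S. norm (a n)) * norm (\<Sum>n<N. x n - x (n + N))"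
      by (intro mult_left_mono large) (simp add: sum_nonneg)
    ultimately have "real N * (c * (\<Sum>n\<in>S. norm (a n))) \<le> real N * (K * norm ?W)"
      by (simp add: mult_ac)
    then have "c * (\<Sum>n\<in>S. norm (a n)) \<le> K * norm ?W" using N by simp
    then have l1: "(\<Sum>n\<in>S. norm (a n)) \<le> K * norm ?W / c" using c by (simp add: field_simps)
    have "norm (\<Sum>n\<in>S. s (b n * a n) (x n)) \<le> (\<Sum>n\<in>S. norm (a n) * M)"
    proof (rule sum_norm_le)
      fix n assume "n \<in> S"
      then have "norm (b n) * norm (a n) \<le> 1 * norm (a n)" using b by (intro mult_right_mono) auto
      then show "norm (s (b n * a n) (x n)) \<le> norm (a n) * M"
        unfolding norm_scale norm_mult using M(2) by (intro mult_mono) auto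
    qed
    also have "\<dots> = M * (\<Sum>n\<in>S. norm (a n))" by (simp add: sum_distrib_left mult.commute)
    also have "\<dots> \<le> M * (K * norm ?W / c)" using l1 M(1) by (intro mult_left_mono) auto
    finally show ?thesis by simp
  qed
  then show ?thesis unfolding bounded_multipliers_def by blast
qed

lemma growth_if_not_bounded_multipliers:
  assumes "\<not> bounded_multipliers"
  shows "\<exists>c>0. (\<forall>N. c * real N \<le> norm (\<Sum>n<N. x n)) \<and>
    (\<forall>e>0. \<exists>N\<ge>1. norm (\<Sum>n<N. x n - x (n + N)) < e * real N)"
proof -
  obtain c where c: "c > 0" "\<And>N. N \<ge> 1 \<Longrightarrow> \<not> norm (\<Sum>n<N. x n) \<le> c * real N"
    using bounded_multipliers_if_averages_small assms by blast
  show ?thesis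
  proof (intro exI[of _ c] conjI allI impI)
    show "c * real N \<le> norm (\<Sum>n<N. x n)" for N
      using c(2)[of N] by (cases "N = 0") auto
    fix e :: real assume "e > 0"
    then obtain N where N: "\<not> e * real N \<le> norm (\<Sum>n<N. x n - x (n + N))"
      using bounded_multipliers_if_differences_large assms by blast
    then have "N \<ge> 1" by (cases N) auto
    then show "\<exists>N\<ge>1. norm (\<Sum>n<N. x n - x (n + N)) < e * real N" using N by (auto simp: not_le)
  qed (rule c(1))
qed

text \<open>
  If the multipliers are not bounded, the sum of the first \<open>2 N\<close> basis vectors has norm at least
  \<open>2 c N\<close>, whereas for some \<open>N\<close> the same sum with half of its signs reversed is small compared with
  \<open>N\<close>.
\<close>

lemma bounded_multipliers_if_constant_coefficients:
  assumes "unconditional_for_constant_coefficients s x"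
  shows bounded_multipliers
proof (rule ccontr)
  assume "\<not> bounded_multipliers"
  then obtain c where c: "c > 0" "\<And>N. c * real N \<le> norm (\<Sum>n<N. x n)"
    and small: "\<And>e. e > 0 \<Longrightarrow> \<exists>N\<ge>1. norm (\<Sum>n<N. x n - x (n + N)) < e * real N"
    using growth_if_not_bounded_multipliers by blast
  obtain D where D: "\<forall>A \<epsilon> \<delta>. finite A \<and> unimodular_on A \<epsilon> \<and> unimodular_on A \<delta> \<longrightarrow>
      norm (signed_indicator s x \<epsilon> A) \<le> D * norm (signed_indicator s x \<delta> A)"
    using assms unfolding unconditional_for_constant_coefficients_def by (rule exE)
  define B where "B = max D 1"
  obtain N where N: "N \<ge> 1" "norm (\<Sum>n<N. x n - x (n + N)) < c / B * real N"
    using small[of "c / B"] c(1) by (auto simp: B_def)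
  define \<delta> where "\<delta> n = (if n < N then 1 else - 1 :: 'k)" for n
  have split: "(\<Sum>n<2 * N. s (e n) (x n)) = (\<Sum>n<N. s (e n) (x n)) + (\<Sum>n<N. s (e (n + N)) (x (n + N)))"
    for e :: "nat \<Rightarrow> 'k"
    using sum.nat_group[of "\<lambda>n. s (e n) (x n)" N 2]
      sum.shift_bounds_nat_ivl[of "\<lambda>n. s (e n) (x n)" 0 N N]
    by (simp add: numeral_2_eq_2 lessThan_atLeast0)
  have "norm (signed_indicator s x (\<lambda>_. 1) {..<2 * N}) \<le> D * norm (signed_indicator s x \<delta> {..<2 * N})"
    by (rule D[rule_format]) (simp add: unimodular_on_def \<delta>_def)
  also have "signed_indicator s x (\<lambda>_. 1) {..<2 * N} = (\<Sum>n<2 * N. x n)"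
    by (simp add: signed_indicator_def)
  also have "signed_indicator s x \<delta> {..<2 * N} = (\<Sum>n<N. x n - x (n + N))"
    unfolding signed_indicator_def split by (simp add: \<delta>_def sum_subtractf sum_negf)
  also have "D * norm (\<Sum>n<N. x n - x (n + N)) \<le> B * norm (\<Sum>n<N. x n - x (n + N))"
    by (intro mult_right_mono) (auto simp: B_def)
  also have "\<dots> < B * (c / B * real N)" using N(2) by (intro mult_strict_left_mono) (auto simp: B_def)
  also have "\<dots> = c * real N" by (simp add: B_def)
  finally have "c * real (2 * N) < c * real N" using c(2)[of "2 * N"] by linarith
  then show False using c(1) by simp
qed

section \<open>Averages of basis vectors\<close>

text \<open>
  The average over \<open>q\<close> blocks of length \<open>N\<close> is the mean of the averages over the single blocks, and
  each of these differs from the average over a remote block by \<open>1/N\<close> times a sum of \<open>N\<close>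
  differences.
\<close>

lemma block_average_close:
  assumes N: "N \<ge> 1" and q: "q \<ge> 1" and L: "q * N \<le> L"
    and small: "norm (\<Sum>n<N. x n - x (n + N)) \<le> e * real N"
  shows "norm ((\<Sum>n<q * N. x n) /\<^sub>R real (q * N) - (\<Sum>n<N. x (n + L)) /\<^sub>R real N) \<le> C * e"
proof -
  have "sum x {i * N..<i * N + N} = (\<Sum>n<N. x (n + i * N))" for i
    using sum.shift_bounds_nat_ivl[of x 0 "i * N" N] by (simp add: lessThan_atLeast0 add.commute)
  then have "(\<Sum>n<q * N. x n) = (\<Sum>i<q. \<Sum>n<N. x (n + i * N))"
    using sum.nat_group[of x N q] by (simp add: mult.commute)
  then have "(\<Sum>n<q * N. x n) - real q *\<^sub>R (\<Sum>n<N. x (n + L))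
      = (\<Sum>i<q. \<Sum>n<N. s 1 (x (n + i * N) - x (n + L)))"
    by (simp add: sum_subtractf sum_constant_scaleR)
  also have "norm \<dots> \<le> (\<Sum>i<q. C * norm (\<Sum>n<N. s 1 (x n - x (n + N))))"
  proof (rule sum_norm_le)
    fix i assume "i \<in> {..<q}"
    then have "Suc i * N \<le> q * N" by (intro mult_right_mono) auto
    then have iL: "N + i * N \<le> L" using L by simp
    show "norm (\<Sum>n<N. s 1 (x (n + i * N) - x (n + L))) \<le> C * norm (\<Sum>n<N. s 1 (x n - x (n + N)))"
      by (rule uniformly_symmetric_differences) (use iL in \<open>auto simp: inj_on_def\<close>)
  qed
  also have "\<dots> \<le> (\<Sum>i<q. C * (e * real N))"
    using small C_ge_1 by (intro sum_mono mult_left_mono) auto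
  also have "\<dots> = real (q * N) * (C * e)" by simp
  finally have "norm ((\<Sum>n<q * N. x n) - real q *\<^sub>R (\<Sum>n<N. x (n + L))) / real (q * N) \<le> C * e"
    using N q by (simp add: field_simps)
  moreover have "(\<Sum>n<q * N. x n) /\<^sub>R real (q * N) - (\<Sum>n<N. x (n + L)) /\<^sub>R real N
      = ((\<Sum>n<q * N. x n) - real q *\<^sub>R (\<Sum>n<N. x (n + L))) /\<^sub>R real (q * N)"
    using N q by (simp add: scaleR_diff_right)
  ultimately show ?thesis by (simp add: divide_inverse mult.commute)
qed

text \<open>
  Both averages are compared with the average over one block beyond \<open>M\<close> and \<open>M'\<close>.
\<close>

lemma averages_close:
  assumes N: "N \<ge> 1" and dvd: "N dvd M" "N dvd M'" and M: "M \<ge> 1" "M' \<ge> 1"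
    and small: "norm (\<Sum>n<N. x n - x (n + N)) \<le> e * real N"
  shows "norm ((\<Sum>n<M. x n) /\<^sub>R real M - (\<Sum>n<M'. x n) /\<^sub>R real M') \<le> 2 * C * e"
proof -
  obtain q q' where q: "M = q * N" "M' = q' * N" using dvd by (metis dvd_def mult.commute)
  let ?v = "(\<Sum>n<N. x (n + max M M')) /\<^sub>R real N"
  have "norm ((\<Sum>n<M. x n) /\<^sub>R real M - ?v) \<le> C * e"
    unfolding q(1) by (rule block_average_close) (use N M q small in \<open>auto simp: Suc_le_eq\<close>)
  moreover have "norm ((\<Sum>n<M'. x n) /\<^sub>R real M' - ?v) \<le> C * e"
    unfolding q(2) by (rule block_average_close) (use N M q small in \<open>auto simp: Suc_le_eq\<close>)
  ultimately show ?thesis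
    using norm_triangle_ineq4[of "(\<Sum>n<M. x n) /\<^sub>R real M - ?v" "(\<Sum>n<M'. x n) /\<^sub>R real M' - ?v"]
    by simp
qed

text \<open>
  The lengths \<open>M\<^sub>k\<close> are products chosen so that a length \<open>N\<^sub>k\<close> with small differences divides \<open>M\<^sub>l\<close>
  for all \<open>l \<ge> k\<close>. The averages of these lengths form a Cauchy sequence.
\<close>

lemma averages_subsequence_converges:
  assumes small: "\<And>e. e > 0 \<Longrightarrow> \<exists>N\<ge>1. norm (\<Sum>n<N. x n - x (n + N)) < e * real N"
  obtains M u where "\<And>k. M k > (k::nat)" "(\<lambda>k. (\<Sum>n<M k. x n) /\<^sub>R real (M k)) \<longlonglongrightarrow> u"
proof -
  have "\<forall>k. \<exists>N\<ge>1. norm (\<Sum>n<N. x n - x (n + N)) < inverse (real (Suc k)) * real N"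
    using small by simp
  then obtain N where N: "\<And>k. N k \<ge> 1"
      "\<And>k. norm (\<Sum>n<N k. x n - x (n + N k)) < inverse (real (Suc k)) * real (N k)"
    by metis
  (* The factors Suc i force M to be unbounded. *)
  define M where "M k = (\<Prod>i\<le>k. Suc i * N i)" for k
  have M_pos: "M k \<ge> 1" for k
    using N(1) by (auto simp: M_def Suc_le_eq intro!: prod_pos simp del: mult_Suc)
  have dvd: "Suc k * N k dvd M l" if "k \<le> l" for k l
    unfolding M_def by (rule dvd_prodI) (use that in auto)
  then have N_dvd: "N k dvd M l" if "k \<le> l" for k l
    using that by (meson dvd_mult_right)
  have M_gt: "M k > k" for k
  proof -
    have "Suc k * N k \<le> M k" using dvd[of k k] M_pos[of k] by (intro dvd_imp_le) auto
    moreover have "Suc k * 1 \<le> Suc k * N k" using N(1) by (intro mult_left_mono) auto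
    ultimately show ?thesis by simp
  qed
  let ?u = "\<lambda>k. (\<Sum>n<M k. x n) /\<^sub>R real (M k)"
  have "Cauchy ?u"
  proof (rule metric_CauchyI)
    fix e :: real assume e: "e > 0"
    then obtain k where k: "inverse (real (Suc k)) < e / (2 * C)"
      using reals_Archimedean[of "e / (2 * C)"] C_ge_1 by auto
    have "dist (?u m) (?u n) < e" if "m \<ge> k" "n \<ge> k" for m n
    proof -
      have "norm (?u m - ?u n) \<le> 2 * C * inverse (real (Suc k))"
        by (rule averages_close[of "N k"])
           (use N(1) less_imp_le[OF N(2)] N_dvd that M_pos in auto)
      also have "\<dots> < e" using k C_ge_1 by (simp add: field_simps)
      finally show ?thesis by (simp add: dist_norm)
    qed
    then show "\<exists>k. \<forall>m\<ge>k. \<forall>n\<ge>k. dist (?u m) (?u n) < e" by blast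
  qed
  then obtain u where "?u \<longlonglongrightarrow> u"
    using Cauchy_convergent convergent_def by blast
  then show thesis using that M_gt by blast
qed

section \<open>The sum functional\<close>

lemma span_expansion:
  assumes "v \<in> span (range x)"
  shows "\<forall>\<^sub>F m in sequentially. (\<Sum>n<m. s (xs n v) (x n)) = v"
proof -
  have lin: "xs n (u + w) = xs n u + xs n w" "xs n 0 = 0" "xs n (s c u) = c * xs n u" for n u w c
    using bounded_linear.linear[OF dual_bounded_linear[OF xs_dual[of n]]] dual_scale[OF xs_dual]
    by (auto simp: linear_add linear_0)
  let ?T = "{v. \<forall>\<^sub>F m in sequentially. (\<Sum>n<m. s (xs n v) (x n)) = v}"
  have "span (range x) \<subseteq> ?T"
  proof (rule span_minimal, rule subsetI)
    fix w assume "w \<in> range x"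
    then obtain k where w: "w = x k" by blast
    have "(\<Sum>n<m. s (xs n w) (x n)) = w" if "m \<ge> Suc k" for m
    proof -
      have "(\<Sum>n<m. s (xs n w) (x n)) = (\<Sum>n<m. if n = k then x k else 0)"
        by (rule sum.cong) (auto simp: w xs_x)
      then show ?thesis using that by (simp add: w)
    qed
    then show "w \<in> ?T"
      unfolding eventually_sequentially by blast
  next
    show "subspace ?T"
    proof (rule subspaceI)
      fix u w
      assume u: "u \<in> ?T"
        and w: "w \<in> ?T"
      from u w have "\<forall>\<^sub>F m in sequentially. (\<Sum>n<m. s (xs n u) (x n)) = u \<and> (\<Sum>n<m. s (xs n w) (x n)) = w"
        by (simp add: eventually_conj_iff)
      then show "u + w \<in> ?T"
        by (auto simp: lin scale_left_distrib sum.distrib elim: eventually_mono)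
    next
      fix c u assume u: "u \<in> ?T"
      have "(\<Sum>n<m. s (xs n (s c u)) (x n)) = s c (\<Sum>n<m. s (xs n u) (x n))" for m
        by (simp add: lin scale_sum_right)
      then show "s c u \<in> ?T"
        using u by (auto elim: eventually_mono)
    qed (simp add: lin)
  qed
  then show ?thesis using assms by auto
qed

lemma dense_induct:
  assumes "closed {v. P v}" "\<And>v. v \<in> span (range x) \<Longrightarrow> P v"
  shows "P v"
  using closure_minimal[of "span (range x)" "{v. P v}"] assms dense by auto

lemma continuous_scale: "continuous_on A (s c)"
proof -
  have "bounded_linear (s c)"
  proof (rule bounded_linear_intro)
    show "s c (r *\<^sub>R v) = r *\<^sub>R s c v" for r v
      by (simp add: scale_left_commute flip: scale_of_real)
    show "norm (s c v) \<le> norm v * norm c" for v by (simp add: norm_scale)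
  qed (rule scale_right_distrib)
  then show ?thesis by (rule linear_continuous_on)
qed

lemma dual_spaceI:
  assumes "\<And>u v. f (u + v) = f u + f v" "\<And>c v. f (s c v) = c * f v"
    "\<And>v. norm (f v) \<le> K * norm v"
  shows "f \<in> dual_space s"
proof -
  have "vector_space ((*) :: 'k \<Rightarrow> 'k \<Rightarrow> 'k)"
    using normed_space_over_times[where 'k = 'k] by (simp add: normed_space_over_def)
  then have "Vector_Spaces.linear s (*) f"
    using assms(1,2) vector_space_axioms by (simp add: Vector_Spaces.linear_iff)
  then show ?thesis using assms(3) by (auto simp: dual_space_def)
qed

text \<open>
  The sum of the coefficients is a Lipschitz functional on the span, so it has a Lipschitz extension
  to the closure, and the extension is linear by density.
\<close>

lemma sum_functional:
  assumes K: "\<And>v m. norm (\<Sum>n<m. xs n v) \<le> K * norm (\<Sum>n<m. s (xs n v) (x n))"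
  shows "\<exists>f\<in>dual_space s. \<forall>n. f (x n) = 1"
proof -
  have lin: "xs n (u + w) = xs n u + xs n w" "xs n (u - w) = xs n u - xs n w" "xs n 0 = 0"
      "xs n (s c u) = c * xs n u" for n u w c
    using bounded_linear.linear[OF dual_bounded_linear[OF xs_dual[of n]]] dual_scale[OF xs_dual]
    by (auto simp: linear_add linear_diff linear_0)
  define f0 where "f0 v = lim (\<lambda>m. \<Sum>n<m. xs n v)" for v
  have f0: "\<forall>\<^sub>F m in sequentially. (\<Sum>n<m. xs n v) = f0 v" if v: "v \<in> span (range x)" for v
  proof -
    obtain m where m: "(\<Sum>n<m. s (xs n v) (x n)) = v"
      using eventually_happens[OF span_expansion[OF v]] by auto
    have zero: "xs n v = 0" if "n \<ge> m" for n
      using xs_sum[of "{..<m}" n "\<lambda>n. xs n v"] that by (simp add: m)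
    have ev: "(\<Sum>n<k. xs n v) = (\<Sum>n<m. xs n v)" if "k \<ge> m" for k
      by (rule sum.mono_neutral_right) (use that zero in auto)
    then have "\<forall>\<^sub>F k in sequentially. (\<Sum>n<k. xs n v) = (\<Sum>n<m. xs n v)"
      unfolding eventually_sequentially by blast
    moreover from this have "f0 v = (\<Sum>n<m. xs n v)"
      unfolding f0_def by (intro limI tendsto_eventually)
    ultimately show ?thesis by simp
  qed
  have f0_le: "norm (f0 v) \<le> K * norm v" if v: "v \<in> span (range x)" for v
  proof -
    obtain m where "(\<Sum>n<m. xs n v) = f0 v" "(\<Sum>n<m. s (xs n v) (x n)) = v"
      using eventually_happens[OF eventually_conj[OF f0[OF v] span_expansion[OF v]]] by auto
    then show ?thesis using K[of v m] by simp
  qed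
  have f0_lin: "f0 (u + w) = f0 u + f0 w" "f0 (u - w) = f0 u - f0 w" "f0 (s c u) = c * f0 u"
    if u: "u \<in> span (range x)" and w: "w \<in> span (range x)" for u w c
  proof -
    have "\<forall>\<^sub>F m in sequentially. (\<Sum>n<m. xs n u) = f0 u \<and> (\<Sum>n<m. xs n w) = f0 w \<and>
        (\<Sum>n<m. xs n (u + w)) = f0 (u + w) \<and> (\<Sum>n<m. xs n (u - w)) = f0 (u - w) \<and>
        (\<Sum>n<m. xs n (s c u)) = f0 (s c u)"
      by (intro eventually_conj f0 u w span_add span_diff span_scale)
    then obtain m where m: "(\<Sum>n<m. xs n u) = f0 u" "(\<Sum>n<m. xs n w) = f0 w"
        "(\<Sum>n<m. xs n (u + w)) = f0 (u + w)" "(\<Sum>n<m. xs n (u - w)) = f0 (u - w)"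
        "(\<Sum>n<m. xs n (s c u)) = f0 (s c u)"
      using eventually_happens by force
    then show "f0 (u + w) = f0 u + f0 w" "f0 (u - w) = f0 u - f0 w" "f0 (s c u) = c * f0 u"
      by (simp_all add: m[symmetric] lin sum.distrib sum_subtractf sum_distrib_left)
  qed
  have "(max K 0)-lipschitz_on (span (range x)) f0"
  proof (rule lipschitz_onI)
    fix u w assume uw: "u \<in> span (range x)" "w \<in> span (range x)"
    have "dist (f0 u) (f0 w) = norm (f0 (u - w))" using f0_lin(2)[OF uw] by (simp add: dist_norm)
    also have "\<dots> \<le> K * norm (u - w)" by (intro f0_le span_diff uw)
    also have "\<dots> \<le> max K 0 * norm (u - w)" by (intro mult_right_mono) auto
    finally show "dist (f0 u) (f0 w) \<le> max K 0 * dist u w" by (simp add: dist_norm)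
  qed simp
  then obtain f where f: "(max K 0)-lipschitz_on (closure (span (range x))) f"
      "\<And>v. v \<in> span (range x) \<Longrightarrow> f v = f0 v"
    using lipschitz_extend_closure by metis
  have lip: "(max K 0)-lipschitz_on UNIV f" using f(1) dense by simp
  have cont: "continuous_on UNIV f" by (rule lipschitz_on_continuous_on[OF lip])
  have cont': "continuous_on A (\<lambda>v. f (g v))" if "continuous_on A g" for A and g :: "'b \<Rightarrow> 'b"
    by (rule continuous_on_compose2[OF cont that]) simp
  have add1: "f (u + w) = f u + f w" if u: "u \<in> span (range x)" for u w
  proof (rule dense_induct[where v = w])
    show "closed {w. f (u + w) = f u + f w}"
      by (intro closed_Collect_eq cont' continuous_intros)
  qed (use u in \<open>simp add: f(2) f0_lin span_add\<close>)
  have add: "f (u + w) = f u + f w" for u w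
  proof (rule dense_induct[where v = u])
    show "closed {u. f (u + w) = f u + f w}"
      by (intro closed_Collect_eq cont' continuous_intros)
  qed (rule add1)
  have scale: "f (s c u) = c * f u" for c u
  proof (rule dense_induct[where v = u])
    show "closed {u. f (s c u) = c * f u}"
      by (intro closed_Collect_eq cont' continuous_intros continuous_scale)
  qed (simp add: f(2) f0_lin span_scale)
  have "f 0 = 0" using scale[of 0 0] by simp
  then have "norm (f v) \<le> max K 0 * norm v" for v
    using lipschitz_onD[OF lip, of v 0] by (simp add: dist_norm)
  with add scale have "f \<in> dual_space s" by (rule dual_spaceI)
  moreover have "f (x n) = 1" for n
  proof -
    have sp: "x n \<in> span (range x)" by (simp add: span_base)
    have "\<forall>\<^sub>F m in sequentially. m > n \<and> (\<Sum>k<m. xs k (x n)) = f0 (x n)"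
      by (intro eventually_conj f0[OF sp] eventually_gt_at_top)
    then obtain m where "m > n" "(\<Sum>k<m. xs k (x n)) = f0 (x n)"
      using eventually_happens by force
    then show ?thesis by (simp add: f(2)[OF sp] xs_x)
  qed
  ultimately show ?thesis by blast
qed

text \<open>
  The functionals that vanish at \<open>u\<close> form a weak* closed set that contains all combinations of
  coordinate functionals.
\<close>

lemma not_markushevich_if_annihilated:
  assumes f: "f \<in> dual_space s" and u: "\<And>n. xs n u = 0" "f u \<noteq> 0"
  shows "\<not> markushevich_basis s x"
proof
  assume "markushevich_basis s x"
  then have "f \<in> weak_star_topology s closure_of {\<lambda>v. \<Sum>n\<in>A. c n * xs n v | A c. finite A}"
    using f by (simp add: markushevich_basis_def)
  moreover have "closedin (weak_star_topology s) {g \<in> topspace (weak_star_topology s). g u \<in> {0}}"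
  proof (rule closedin_continuous_map_preimage)
    show "continuous_map (weak_star_topology s) euclidean (\<lambda>g. g u)"
      unfolding weak_star_topology_def
      by (intro continuous_map_from_subtopology continuous_map_product_projection) simp
  qed simp
  then have "weak_star_topology s closure_of
        (topspace (weak_star_topology s) \<inter> {\<lambda>v. \<Sum>n\<in>A. c n * xs n v | A c. finite A})
      \<subseteq> {g \<in> topspace (weak_star_topology s). g u \<in> {0}}"
    by (rule closure_of_minimal[rotated]) (auto simp: u(1))
  ultimately show False using u(2) by (subst (asm) closure_of_restrict) blast
qed

text \<open>
  If the multipliers are not bounded, the coefficient sum \<open>f\<close> is a bounded functional and averages of
  lengths \<open>M\<^sub>k \<rightarrow> \<infinity>\<close> converge to some \<open>u\<close>. Each average has coefficient sum \<open>1\<close> and coordinates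
  \<open>0\<close> or \<open>1/M\<^sub>k\<close>, so \<open>f u = 1\<close> while all coordinates of \<open>u\<close> vanish.
\<close>

lemma bounded_multipliers_if_markushevich:
  assumes "markushevich_basis s x"
  shows bounded_multipliers
proof (rule ccontr)
  assume "\<not> bounded_multipliers"
  then obtain c where c: "c > 0" "\<And>N. c * real N \<le> norm (\<Sum>n<N. x n)"
    and small: "\<And>e. e > 0 \<Longrightarrow> \<exists>N\<ge>1. norm (\<Sum>n<N. x n - x (n + N)) < e * real N"
    using growth_if_not_bounded_multipliers by blast
  have "norm (\<Sum>n<m. xs n v) \<le> C / c * norm (\<Sum>n<m. s (xs n v) (x n))" for v m
  proof (cases "m = 0")
    case False
    have "norm (\<Sum>n<m. xs n v) * (c * real m) \<le> norm (\<Sum>n<m. xs n v) * norm (\<Sum>n<m. x n)"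
      by (intro mult_left_mono c) simp
    also have "\<dots> \<le> real m * (C * norm (\<Sum>n<m. s (xs n v) (x n)))"
      by (rule averaging[OF normed_space_over_axioms]) (auto intro: C_nat)
    finally show ?thesis using False c(1) by (simp add: field_simps)
  qed simp
  from sum_functional[OF this] obtain f where f: "f \<in> dual_space s" "\<And>n. f (x n) = 1"
    by blast
  obtain M u where M: "\<And>k. M k > (k::nat)"
    and u: "(\<lambda>k. (\<Sum>n<M k. x n) /\<^sub>R real (M k)) \<longlonglongrightarrow> u"
    using averages_subsequence_converges[OF small] by blast
  have M0: "M k > 0" for k using M[of k] by simp
  have lim: "(\<lambda>k. (\<Sum>n<M k. g (x n)) /\<^sub>R real (M k)) \<longlonglongrightarrow> g u" if g: "g \<in> dual_space s" for g
  proof -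
    note lg = dual_bounded_linear[OF g]
    have "g ((\<Sum>n<M k. x n) /\<^sub>R real (M k)) = (\<Sum>n<M k. g (x n)) /\<^sub>R real (M k)" for k
      using bounded_linear.linear[OF lg] by (simp add: linear_scale linear_sum)
    then show ?thesis using bounded_linear.tendsto[OF lg u] by simp
  qed
  have "(\<lambda>k. (\<Sum>n<M k. f (x n)) /\<^sub>R real (M k)) = (\<lambda>_. 1)"
    using M0 by (simp add: f(2) scaleR_conv_of_real fun_eq_iff)
  then have "f u = 1"
    using lim[OF f(1)] LIMSEQ_unique[OF _ tendsto_const[of "1::'k"]] by metis
  moreover have "xs n u = 0" for n
  proof (rule LIMSEQ_unique[OF lim[OF xs_dual]])
    show "(\<lambda>k. (\<Sum>i<M k. xs n (x i)) /\<^sub>R real (M k)) \<longlonglongrightarrow> 0"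
    proof (rule tendsto_norm_zero_cancel, rule tendsto_sandwich[OF _ _ tendsto_const LIMSEQ_inverse_real_of_nat])
      show "\<forall>\<^sub>F k in sequentially. norm ((\<Sum>i<M k. xs n (x i)) /\<^sub>R real (M k)) \<le> inverse (real (Suc k))"
      proof (rule always_eventually, rule allI)
        fix k
        have "real (Suc k) \<le> real (M k)" using M[of k] by linarith
        moreover have "norm (\<Sum>i<M k. xs n (x i)) \<le> 1" by (simp add: xs_x)
        ultimately have "inverse (real (M k)) * norm (\<Sum>i<M k. xs n (x i)) \<le> inverse (real (Suc k)) * 1"
          by (intro mult_mono le_imp_inverse_le) auto
        then show "norm ((\<Sum>i<M k. xs n (x i)) /\<^sub>R real (M k)) \<le> inverse (real (Suc k))" by simp
      qed
    qed simp
  qed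
  ultimately show False
    using not_markushevich_if_annihilated[OF f(1), of u] assms by simp
qed

section \<open>Consequences of bounded multipliers\<close>

lemma coordinate_continuous: "continuous_on A (\<lambda>v. s (c * xs n v) (x n))"
proof -
  note lin = dual_bounded_linear[OF xs_dual[of n]]
  have "bounded_linear (\<lambda>v. s (c * xs n v) (x n))"
  proof (rule bounded_linear_intro)
    show "s (c * xs n (u + v)) (x n) = s (c * xs n u) (x n) + s (c * xs n v) (x n)" for u v
      by (simp add: linear_add[OF bounded_linear.linear[OF lin]] distrib_left scale_left_distrib)
    show "s (c * xs n (r *\<^sub>R v)) (x n) = r *\<^sub>R s (c * xs n v) (x n)" for r v
    proof -
      have "s (c * xs n (r *\<^sub>R v)) (x n) = s (of_real r * (c * xs n v)) (x n)"
        by (simp add: linear_scale[OF bounded_linear.linear[OF lin]] scaleR_conv_of_real mult.left_commute)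
      then show ?thesis by (simp only: scale_scale[symmetric, of "of_real r"] scale_of_real)
    qed
    show "norm (s (c * xs n v) (x n)) \<le> norm v * (norm c * onorm (xs n) * norm (x n))" for v
      using mult_left_mono[OF onorm[OF lin, of v], of "norm c * norm (x n)"]
      by (simp add: norm_scale norm_mult mult_ac)
  qed
  then show ?thesis by (rule linear_continuous_on)
qed

text \<open>
  The bound for finite combinations passes to the truncated expansions of every vector, because those
  depend continuously on the vector and the span is dense.
\<close>

lemma coordinate_multiplier_bound:
  assumes bounded_multipliers
  shows "\<exists>K\<ge>1. (\<forall>S a b. finite S \<longrightarrow> (\<forall>n\<in>S. norm (b n) \<le> 1) \<longrightarrow>
      norm (\<Sum>n\<in>S. s (b n * a n) (x n)) \<le> K * norm (\<Sum>n\<in>S. s (a n) (x n))) \<and>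
    (\<forall>S b v. finite S \<longrightarrow> (\<forall>n\<in>S. norm (b n) \<le> 1) \<longrightarrow>
      norm (\<Sum>n\<in>S. s (b n * xs n v) (x n)) \<le> K * norm v)"
proof -
  obtain K0 where K0: "\<forall>S a b. finite S \<longrightarrow> (\<forall>n\<in>S. norm (b n) \<le> 1) \<longrightarrow>
      norm (\<Sum>n\<in>S. s (b n * a n) (x n)) \<le> K0 * norm (\<Sum>n\<in>S. s (a n) (x n))"
    using assms unfolding bounded_multipliers_def by (rule exE)
  define K where "K = max K0 1"
  have K: "norm (\<Sum>n\<in>S. s (b n * a n) (x n)) \<le> K * norm (\<Sum>n\<in>S. s (a n) (x n))"
    if "finite S" "\<forall>n\<in>S. norm (b n) \<le> 1" for S a b
  proof -
    have "norm (\<Sum>n\<in>S. s (b n * a n) (x n)) \<le> K0 * norm (\<Sum>n\<in>S. s (a n) (x n))"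
      using K0 that by blast
    also have "\<dots> \<le> K * norm (\<Sum>n\<in>S. s (a n) (x n))"
      by (intro mult_right_mono) (auto simp: K_def)
    finally show ?thesis .
  qed
  have "norm (\<Sum>n\<in>S. s (b n * xs n v) (x n)) \<le> K * norm v"
    if S: "finite S" and b: "\<forall>n\<in>S. norm (b n) \<le> 1" for S b v
  proof (rule dense_induct[where v = v])
    show "closed {v. norm (\<Sum>n\<in>S. s (b n * xs n v) (x n)) \<le> K * norm v}"
      by (intro closed_Collect_le continuous_intros coordinate_continuous)
    fix v assume v: "v \<in> span (range x)"
    obtain k where k: "S \<subseteq> {..<k}" using S finite_nat_bounded by blast
    obtain m where m: "m \<ge> k" "(\<Sum>n<m. s (xs n v) (x n)) = v"
      using eventually_happens[OF eventually_conj[OF eventually_ge_at_top[of k] span_expansion[OF v]]]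
      by auto
    let ?b = "\<lambda>n. if n \<in> S then b n else 0"
    have "(\<Sum>n\<in>S. s (b n * xs n v) (x n)) = (\<Sum>n<m. s (?b n * xs n v) (x n))"
      by (rule sum.mono_neutral_cong_left) (use k m(1) in auto)
    also have "norm \<dots> \<le> K * norm (\<Sum>n<m. s (xs n v) (x n))"
      by (rule K) (use b in auto)
    finally show "norm (\<Sum>n\<in>S. s (b n * xs n v) (x n)) \<le> K * norm v" by (simp only: m(2))
  qed
  then show ?thesis using K by (intro exI[of _ K]) (auto simp: K_def)
qed

text \<open>
  The rearranged partial sums are uniformly bounded operators, and on a vector of the span they are
  eventually the identity.
\<close>

lemma unconditional_if_bounded_multipliers:
  assumes bounded_multipliers
  shows "unconditional_basis s x"
proof -
  obtain K where K: "K \<ge> 1" "\<forall>S b v. finite S \<longrightarrow> (\<forall>n\<in>S. norm (b n) \<le> 1) \<longrightarrow>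
      norm (\<Sum>n\<in>S. s (b n * xs n v) (x n)) \<le> K * norm v"
    using coordinate_multiplier_bound[OF assms] by blast
  have K': "norm (\<Sum>n\<in>S. s (xs n v) (x n)) \<le> K * norm v" if "finite S" for S v
    using K(2)[rule_format, of S "\<lambda>_. 1" v] that by simp
  have "(\<lambda>i. s (xs (\<pi> i) v) (x (\<pi> i))) sums v" if \<pi>: "bij \<pi>" for v \<pi>
    unfolding sums_def
  proof (rule LIMSEQ_I)
    fix e :: real assume e: "e > 0"
    then have "e / (K + 1) > 0" using K(1) by simp
    then obtain w where w: "w \<in> span (range x)" "dist w v < e / (K + 1)"
      using dense closure_approachable[of v "span (range x)"] by blast
    obtain m where m: "(\<Sum>n<m. s (xs n w) (x n)) = w"
      using eventually_happens[OF span_expansion[OF w(1)]] by auto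
    have zero: "xs n w = 0" if "n \<ge> m" for n
      using xs_sum[of "{..<m}" n "\<lambda>n. xs n w"] that by (simp add: m)
    obtain N0 where N0: "inv \<pi> ` {..<m} \<subseteq> {..<N0}" using finite_nat_bounded by blast
    have "norm ((\<Sum>i<N. s (xs (\<pi> i) v) (x (\<pi> i))) - v) < e" if N: "N \<ge> N0" for N
    proof -
      let ?A = "\<pi> ` {..<N}"
      have sub: "{..<m} \<subseteq> ?A"
      proof
        fix n assume "n \<in> {..<m}"
        then have "inv \<pi> n \<in> {..<N}" using N0 N by fastforce
        moreover have "\<pi> (inv \<pi> n) = n" using \<pi> by (simp add: bij_is_surj surj_f_inv_f)
        ultimately show "n \<in> ?A" by (metis imageI)
      qed
      have re: "(\<Sum>i<N. s (xs (\<pi> i) v) (x (\<pi> i))) = (\<Sum>n\<in>?A. s (xs n v) (x n))"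
        using \<pi> by (simp add: sum.reindex bij_is_inj inj_on_subset[of \<pi> UNIV])
      have w': "(\<Sum>n\<in>?A. s (xs n w) (x n)) = w"
      proof -
        have "(\<Sum>n<m. s (xs n w) (x n)) = (\<Sum>n\<in>?A. s (xs n w) (x n))"
          by (rule sum.mono_neutral_left) (use sub zero in auto)
        then show "(\<Sum>n\<in>?A. s (xs n w) (x n)) = w" by (simp only: m)
      qed
      have "xs n (v - w) = xs n v - xs n w" for n
        using bounded_linear.linear[OF dual_bounded_linear[OF xs_dual]] by (simp add: linear_diff)
      then have "(\<Sum>n\<in>?A. s (xs n v) (x n)) - v = (\<Sum>n\<in>?A. s (xs n (v - w)) (x n)) + (w - v)"
        by (simp add: scale_left_diff_distrib sum_subtractf w')
      then have "norm ((\<Sum>n\<in>?A. s (xs n v) (x n)) - v)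
          \<le> norm (\<Sum>n\<in>?A. s (xs n (v - w)) (x n)) + norm (w - v)"
        by (simp only: norm_triangle_ineq)
      also have "\<dots> \<le> K * norm (v - w) + norm (w - v)"
        using K'[of ?A "v - w"] by simp
      also have "\<dots> = (K + 1) * dist w v" by (simp add: dist_norm norm_minus_commute algebra_simps)
      also have "\<dots> < (K + 1) * (e / (K + 1))"
        using w(2) K(1) by (intro mult_strict_left_mono) auto
      also have "\<dots> = e" using K(1) by simp
      finally show ?thesis by (simp only: re)
    qed
    then show "\<exists>N0. \<forall>N\<ge>N0. norm ((\<Sum>i<N. s (xs (\<pi> i) v) (x (\<pi> i))) - v) < e" by blast
  qed
  then show ?thesis using basis by (simp add: unconditional_basis_def)
qed

text \<open>
  The quotients of two unimodular coefficients form a multiplier; a bijection between \<open>A\<close> and \<open>B\<close>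
  then exchanges the basis vectors.
\<close>

lemma super_democratic_if_bounded_multipliers:
  assumes bounded_multipliers
  shows "super_democratic s x"
proof -
  obtain K where K: "K \<ge> 1" "\<forall>S a b. finite S \<longrightarrow> (\<forall>n\<in>S. norm (b n) \<le> 1) \<longrightarrow>
      norm (\<Sum>n\<in>S. s (b n * a n) (x n)) \<le> K * norm (\<Sum>n\<in>S. s (a n) (x n))"
    using coordinate_multiplier_bound[OF assms] by blast
  have "norm (signed_indicator s x \<epsilon> A) \<le> (K * C) * norm (signed_indicator s x \<delta> B)"
    if AB: "finite A" "finite B" "card A = card B" and u: "unimodular_on A \<epsilon>" "unimodular_on B \<delta>"
    for A B \<epsilon> \<delta>
  proof -
    obtain g where g: "bij_betw g A B" using AB finite_same_card_bij by blast
    then have gB: "g n \<in> B" if "n \<in> A" for n using that by (auto simp: bij_betw_def)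
    have nz: "\<delta> n \<noteq> 0" if "n \<in> B" for n using u(2) that by (auto simp: unimodular_on_def)
    have "signed_indicator s x \<epsilon> A = (\<Sum>n\<in>A. s (\<epsilon> n / \<delta> (g n) * \<delta> (g n)) (x n))"
      unfolding signed_indicator_def by (rule sum.cong) (use nz gB in auto)
    also have "norm \<dots> \<le> K * norm (\<Sum>n\<in>A. s (\<delta> (g n)) (x n))"
      by (rule K(2)[rule_format]) (use u gB AB in \<open>auto simp: unimodular_on_def norm_divide\<close>)
    also have "\<dots> \<le> K * (C * norm (\<Sum>n\<in>A. s (\<delta> (g n)) (x (g n))))"
      using K(1) g AB(1)
      by (intro mult_left_mono uniformly_symmetric) (auto simp: bij_betw_def inj_on_def)
    also have "(\<Sum>n\<in>A. s (\<delta> (g n)) (x (g n))) = signed_indicator s x \<delta> B"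
      unfolding signed_indicator_def by (rule sum.reindex_bij_betw[OF g])
    finally show ?thesis by (simp add: mult.assoc)
  qed
  then show ?thesis unfolding super_democratic_def by blast
qed

text \<open>
  Let \<open>\<phi>\<close> be the norm of the sum of the first \<open>m\<close> basis vectors. Symmetry and a multiplier that is
  zero outside the image of \<open>A\<close> bound the signed indicator of \<open>A\<close> by a multiple of \<open>\<phi>\<close>. Averaging the
  coefficients \<open>\<delta>\<^sub>n x\<^sub>n\<^sup>* v\<close> over rotations bounds the dual indicator of \<open>B\<close> at \<open>v\<close> by a multiple of
  \<open>m / \<phi>\<close> times the norm of \<open>v\<close>.
\<close>

lemma bidemocratic_if_bounded_multipliers:
  assumes bounded_multipliers
  shows "bidemocratic s x"
proof -
  obtain K where K: "K \<ge> 1" "\<forall>S a b. finite S \<longrightarrow> (\<forall>n\<in>S. norm (b n) \<le> 1) \<longrightarrow>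
      norm (\<Sum>n\<in>S. s (b n * a n) (x n)) \<le> K * norm (\<Sum>n\<in>S. s (a n) (x n))"
    "\<forall>S b v. finite S \<longrightarrow> (\<forall>n\<in>S. norm (b n) \<le> 1) \<longrightarrow>
      norm (\<Sum>n\<in>S. s (b n * xs n v) (x n)) \<le> K * norm v"
    using coordinate_multiplier_bound[OF assms] by blast
  have "norm (signed_indicator s x \<epsilon> A) * onorm (dual_signed_indicator s x \<delta> B) \<le> (C * K)\<^sup>2 * real m"
    if AB: "finite A" "finite B" "max (card A) (card B) \<le> m"
      and u: "unimodular_on A \<epsilon>" "unimodular_on B \<delta>"
    for m A B \<epsilon> \<delta>
  proof -
    define \<phi> where "\<phi> = norm (\<Sum>n<m. x n)"
    let ?f = "dual_signed_indicator s x \<delta> B"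
    obtain h where h: "inj_on h A" "h ` A \<subseteq> {..<m}"
      using AB card_le_inj[of A "{..<m}"] by auto
    let ?b = "\<lambda>n. if n \<in> h ` A then \<epsilon> (inv_into A h n) else 0"
    have "norm (signed_indicator s x \<epsilon> A) \<le> C * norm (\<Sum>n\<in>A. s (\<epsilon> n) (x (h n)))"
      unfolding signed_indicator_def by (rule uniformly_symmetric) (use AB h in auto)
    also have "(\<Sum>n\<in>A. s (\<epsilon> n) (x (h n))) = (\<Sum>n\<in>h ` A. s (?b n) (x n))"
      by (simp add: sum.reindex h(1))
    also have "\<dots> = (\<Sum>n<m. s (?b n * 1) (x n))"
      by (rule sum.mono_neutral_cong_left) (use h(2) in auto)
    also have "C * norm \<dots> \<le> C * (K * norm (\<Sum>n<m. s 1 (x n)))"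
    proof (intro mult_left_mono K(2)[rule_format])
      show "norm (?b n) \<le> 1" for n
        using u(1) h(1) by (auto simp: unimodular_on_def)
    qed (use C_ge_1 in auto)
    finally have A: "norm (signed_indicator s x \<epsilon> A) \<le> C * K * \<phi>" by (simp add: \<phi>_def mult.assoc)
    have f: "norm (?f v) * \<phi> \<le> real m * (C * K * norm v)" for v
      unfolding dual_signed_indicator_def \<phi>_def
    proof (rule averaging[OF normed_space_over_axioms])
      fix p :: "nat \<Rightarrow> nat" assume p: "inj_on p B"
      have "norm (\<Sum>n\<in>B. s (\<delta> n * xs n v) (x (p n))) \<le> C * norm (\<Sum>n\<in>B. s (\<delta> n * xs n v) (x n))"
        by (rule C_nat) (use AB p in auto)
      also have "\<dots> \<le> C * (K * norm v)"
        using C_ge_1 AB u by (intro mult_left_mono K(3)[rule_format]) (auto simp: unimodular_on_def)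
      finally show "norm (\<Sum>n\<in>B. s (\<delta> n * xs n v) (x (p n))) \<le> C * K * norm v" by (simp add: mult.assoc)
    qed (use AB in auto)
    show ?thesis
    proof (cases "\<phi> = 0")
      case True
      then show ?thesis using A by simp
    next
      case False
      then have \<phi>: "\<phi> > 0" by (simp add: \<phi>_def)
      have "onorm ?f \<le> real m * (C * K) / \<phi>"
        by (rule onorm_bound) (use f \<phi> C_ge_1 K(1) in \<open>auto simp: field_simps\<close>)
      then have "norm (signed_indicator s x \<epsilon> A) * onorm ?f
          \<le> norm (signed_indicator s x \<epsilon> A) * (real m * (C * K) / \<phi>)"
        by (rule mult_left_mono) simp
      also have "\<dots> \<le> (C * K * \<phi>) * (real m * (C * K) / \<phi>)"
        by (rule mult_right_mono[OF A]) (use \<phi> C_ge_1 K(1) in simp)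
      also have "\<dots> = (C * K)\<^sup>2 * real m" using \<phi> by (simp add: power2_eq_square)
      finally show ?thesis .
    qed
  qed
  then show ?thesis unfolding bidemocratic_def by blast
qed

section \<open>The remaining implications\<close>

lemma constant_coefficients_if_super_democratic:
  assumes "super_democratic s x"
  shows "unconditional_for_constant_coefficients s x"
proof -
  obtain D where D: "\<forall>A B \<epsilon> \<delta>. finite A \<and> finite B \<and> card A = card B \<and>
      unimodular_on A \<epsilon> \<and> unimodular_on B \<delta> \<longrightarrow>
      norm (signed_indicator s x \<epsilon> A) \<le> D * norm (signed_indicator s x \<delta> B)"
    using assms unfolding super_democratic_def by (rule exE)
  show ?thesis
    unfolding unconditional_for_constant_coefficients_def
    by (intro exI[of _ D] allI impI D[rule_format]) auto
qed

text \<open>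
  The dual indicator with the inverse coefficients takes the value \<open>card A\<close> at the signed indicator
  with coefficients \<open>\<delta>\<close>, so the product of the two norms is at least \<open>card A\<close>. Bidemocracy bounds
  the norm of the former times that of any other signed indicator of \<open>A\<close> by a multiple of \<open>card A\<close>.
\<close>

lemma constant_coefficients_if_bidemocratic:
  assumes "bidemocratic s x"
  shows "unconditional_for_constant_coefficients s x"
proof -
  obtain D where D: "\<forall>m A B \<epsilon> \<delta>. finite A \<and> finite B \<and> max (card A) (card B) \<le> m \<and>
        unimodular_on A \<epsilon> \<and> unimodular_on B \<delta> \<longrightarrow>
        norm (signed_indicator s x \<epsilon> A) * onorm (dual_signed_indicator s x \<delta> B) \<le> D * real m"
    using assms unfolding bidemocratic_def by (rule exE)
  have "norm (signed_indicator s x \<epsilon> A) \<le> D * norm (signed_indicator s x \<delta> A)"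
    if A: "finite A" and u: "unimodular_on A \<epsilon>" "unimodular_on A \<delta>" for A \<epsilon> \<delta>
  proof (cases "A = {}")
    case True
    then show ?thesis by (simp add: signed_indicator_def)
  next
    case False
    let ?f = "dual_signed_indicator s x (\<lambda>n. inverse (\<delta> n)) A"
    let ?a = "norm (signed_indicator s x \<epsilon> A)" and ?d = "norm (signed_indicator s x \<delta> A)"
    have card: "card A > 0" using A False by (simp add: card_gt_0_iff)
    have nz: "\<delta> n \<noteq> 0" if "n \<in> A" for n using u(2) that by (auto simp: unimodular_on_def)
    have "?f (signed_indicator s x \<delta> A) = (\<Sum>n\<in>A. 1)"
      unfolding dual_signed_indicator_def signed_indicator_def
      by (rule sum.cong) (use A nz in \<open>auto simp: xs_sum\<close>)
    moreover have "bounded_linear ?f"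
      unfolding dual_signed_indicator_def
      by (intro bounded_linear_sum bounded_linear_compose[OF bounded_linear_mult_right]
          dual_bounded_linear xs_dual)
    ultimately have "real (card A) \<le> onorm ?f * ?d"
      using onorm[of ?f "signed_indicator s x \<delta> A"] by simp
    then have "?a * real (card A) \<le> ?a * (onorm ?f * ?d)"
      by (rule mult_left_mono) simp
    also have "\<dots> = (?a * onorm ?f) * ?d" by simp
    also have "\<dots> \<le> (D * real (card A)) * ?d"
      using D[rule_format, of A A "card A" \<epsilon> "\<lambda>n. inverse (\<delta> n)"] A u
      by (intro mult_right_mono) (auto simp: unimodular_on_def norm_inverse)
    finally show ?thesis using card by (simp add: mult.commute mult.left_commute)
  qed
  then show ?thesis unfolding unconditional_for_constant_coefficients_def by blast
qed

text \<open>
  Applying \<open>f\<close> to the partial sums of the expansion of \<open>v\<close> gives combinations of coordinate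
  functionals with coefficients \<open>f (x n)\<close>, and these converge to \<open>f v\<close>.
\<close>

lemma markushevich_if_unconditional:
  assumes "unconditional_basis s x"
  shows "markushevich_basis s x"
proof -
  let ?S = "{\<lambda>v. \<Sum>n\<in>A. c n * xs n v | A c. finite A}"
  have top: "topspace (weak_star_topology s) = dual_space s"
    by (simp add: weak_star_topology_def)
  have "f \<in> weak_star_topology s closure_of ?S" if f: "f \<in> dual_space s" for f
  proof -
    define g where "g N v = (\<Sum>n<N. f (x n) * xs n v)" for N v
    have g_f: "g N v = f (\<Sum>n<N. s (xs n v) (x n))" for N v
      by (simp add: g_def dual_sum[OF f] mult.commute)
    have lim: "(\<lambda>N. g N v) \<longlonglongrightarrow> f v" for v
    proof -
      have "(\<lambda>i. s (xs (id i) v) (x (id i))) sums v"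
        using assms bij_id unfolding unconditional_basis_def by blast
      then show ?thesis
        using bounded_linear.tendsto[OF dual_bounded_linear[OF f]] by (simp add: sums_def g_f)
    qed
    have "g N \<in> dual_space s" for N
    proof (rule dual_spaceI)
      have bl: "bounded_linear (g N)"
        unfolding g_def by (intro bounded_linear_sum bounded_linear_compose[OF bounded_linear_mult_right]
            dual_bounded_linear xs_dual)
      show "g N (u + v) = g N u + g N v" for u v
        by (rule linear_add[OF bounded_linear.linear[OF bl]])
      show "g N (s c v) = c * g N v" for c v
        by (simp add: g_def dual_scale[OF xs_dual] sum_distrib_left mult.left_commute)
      show "norm (g N v) \<le> onorm (g N) * norm v" for v by (rule onorm[OF bl])
    qed
    moreover have "limitin (product_topology (\<lambda>_. euclidean) UNIV) g f sequentially"
      using lim by (simp add: limitin_componentwise)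
    ultimately have lim': "limitin (weak_star_topology s) g f sequentially"
      using f by (simp add: weak_star_topology_def limitin_subtopology)
    have g_in: "g N \<in> ?S" for N
      unfolding g_def by (intro CollectI exI[of _ "{..<N}"] exI[of _ "\<lambda>n. f (x n)"]) simp
    show ?thesis
      unfolding in_closure_of
    proof (intro conjI allI impI)
      show "f \<in> topspace (weak_star_topology s)" using f top by simp
      fix T assume "f \<in> T \<and> openin (weak_star_topology s) T"
      then have "\<forall>\<^sub>F N in sequentially. g N \<in> T" using lim' by (simp add: limitin_def)
      then obtain N where "g N \<in> T" using eventually_happens by fastforce
      then show "\<exists>h. h \<in> ?S \<and> h \<in> T" using g_in by (intro exI[of _ "g N"] conjI)
    qed
  qed
  then have "weak_star_topology s closure_of ?S = dual_space s"
    using closure_of_subset_topspace[of "weak_star_topology s" ?S] top by blast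
  then show ?thesis using basis by (simp add: markushevich_basis_def)
qed

lemma equivalent_conditions:
  "all_equivalent [unconditional_basis s x, bidemocratic s x, super_democratic s x,
     unconditional_for_constant_coefficients s x, markushevich_basis s x]"
proof -
  have "unconditional_basis s x \<longleftrightarrow> bounded_multipliers"
    using unconditional_if_bounded_multipliers markushevich_if_unconditional
      bounded_multipliers_if_markushevich by blast
  moreover have "bidemocratic s x \<longleftrightarrow> bounded_multipliers"
    using bidemocratic_if_bounded_multipliers constant_coefficients_if_bidemocratic
      bounded_multipliers_if_constant_coefficients by blast
  moreover have "super_democratic s x \<longleftrightarrow> bounded_multipliers"
    using super_democratic_if_bounded_multipliers constant_coefficients_if_super_democratic
      bounded_multipliers_if_constant_coefficients by blast
  moreover have "unconditional_for_constant_coefficients s x \<longleftrightarrow> bounded_multipliers"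
    using super_democratic_if_bounded_multipliers constant_coefficients_if_super_democratic
      bounded_multipliers_if_constant_coefficients by blast
  moreover have "markushevich_basis s x \<longleftrightarrow> bounded_multipliers"
    using unconditional_if_bounded_multipliers markushevich_if_unconditional
      bounded_multipliers_if_markushevich by blast
  ultimately show ?thesis by (simp add: all_equivalent_def)
qed

end

lemma symmetric_basis_over_real:
  assumes "symmetric_basis (scaleR :: real \<Rightarrow> 'a::banach \<Rightarrow> 'a) x"
  shows "symmetric_basis_over (scaleR :: real \<Rightarrow> 'a \<Rightarrow> 'a) x 0"
proof (intro symmetric_basis_over.intro symmetric_basis_over_axioms.intro
    normed_space_over_scaleR assms)
  show "\<exists>p q. c = of_real p + of_real q * 0 \<and> \<bar>p\<bar> \<le> norm c \<and> \<bar>q\<bar> \<le> norm c" for c :: real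
    by (intro exI[of _ c] exI[of _ 0]) simp
qed simp

lemma symmetric_basis_over_complex:
  fixes s :: "complex \<Rightarrow> 'b::banach \<Rightarrow> 'b"
  assumes "normed_space_over s" "symmetric_basis s y"
  shows "symmetric_basis_over s y \<i>"
proof (intro symmetric_basis_over.intro symmetric_basis_over_axioms.intro assms)
  fix c :: complex
  have "c = of_real (Re c) + of_real (Im c) * \<i>" by (simp add: complex_eq_iff)
  then show "\<exists>p q. c = of_real p + of_real q * \<i> \<and> \<bar>p\<bar> \<le> norm c \<and> \<bar>q\<bar> \<le> norm c"
    using abs_Re_le_cmod abs_Im_le_cmod by blast
qed simp

theorem corollary3p8:
  fixes x :: "nat \<Rightarrow> 'a::banach"
    and s :: "complex \<Rightarrow> 'b::banach \<Rightarrow> 'b" and y :: "nat \<Rightarrow> 'b"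
  shows "(symmetric_basis ((*\<^sub>R) :: real \<Rightarrow> 'a \<Rightarrow> 'a) x \<longrightarrow>
            all_equivalent
              [unconditional_basis ((*\<^sub>R) :: real \<Rightarrow> 'a \<Rightarrow> 'a) x,
               bidemocratic ((*\<^sub>R) :: real \<Rightarrow> 'a \<Rightarrow> 'a) x,
               super_democratic ((*\<^sub>R) :: real \<Rightarrow> 'a \<Rightarrow> 'a) x,
               unconditional_for_constant_coefficients ((*\<^sub>R) :: real \<Rightarrow> 'a \<Rightarrow> 'a) x,
               markushevich_basis ((*\<^sub>R) :: real \<Rightarrow> 'a \<Rightarrow> 'a) x])
       \<and> (normed_space_over s \<and> symmetric_basis s y \<longrightarrow>
            all_equivalent
              [unconditional_basis s y,
               bidemocratic s y,
               super_democratic s y,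
               unconditional_for_constant_coefficients s y,
               markushevich_basis s y])"
proof (intro conjI impI)
  assume "symmetric_basis ((*\<^sub>R) :: real \<Rightarrow> 'a \<Rightarrow> 'a) x"
  then interpret symmetric_basis_over "(*\<^sub>R) :: real \<Rightarrow> 'a \<Rightarrow> 'a" x 0
    by (rule symmetric_basis_over_real)
  show "all_equivalent
              [unconditional_basis ((*\<^sub>R) :: real \<Rightarrow> 'a \<Rightarrow> 'a) x,
               bidemocratic ((*\<^sub>R) :: real \<Rightarrow> 'a \<Rightarrow> 'a) x,
               super_democratic ((*\<^sub>R) :: real \<Rightarrow> 'a \<Rightarrow> 'a) x,
               unconditional_for_constant_coefficients ((*\<^sub>R) :: real \<Rightarrow> 'a \<Rightarrow> 'a) x,
               markushevich_basis ((*\<^sub>R) :: real \<Rightarrow> 'a \<Rightarrow> 'a) x]"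
    by (rule equivalent_conditions)
next
  assume "normed_space_over s \<and> symmetric_basis s y"
  then interpret symmetric_basis_over s y \<i>
    by (intro symmetric_basis_over_complex) auto
  show "all_equivalent [unconditional_basis s y, bidemocratic s y, super_democratic s y,
      unconditional_for_constant_coefficients s y, markushevich_basis s y]"
    by (rule equivalent_conditions)
qed

end
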